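(* Let $m\ge 2$ and let $\overline{\mathcal T}$ be the asymptotic fringe tree of the random $m$-ary search tree (internal nodes only). The number $K$ of keys in $\overline{\mathcal T}$ has the distribution $$\mathbb P(K=k)=\frac{2}{(k+1)(k+2)},\qquad k\ge 1 .$$ Furthermore, $\overline{\mathcal T}$ can be described as an $m$-ary search tree $T_K$ with a random number $K$ of keys, where $K$ has this distribution; that is, for every $k\ge1$, conditioned on $K=k$, $\overline{\mathcal T}$ has the same distribution as the random $m$-ary search tree $T_k$ with $k$ keys.
   Context: $m$-ary search tree: each node holds up to $m-1$ keys (distinct reals). Start with an empty root. The first $m-1$ keys are stored in the root; when the root becomes full, $m$ new empty nodes are added as its children $1,\dots,m$. The $m-1$ keys divide $\mathbb R$ into intervals $J_1,\dots,J_m$; each further key lying in $J_i$ is passed to child $i$, where the same rule is applied recursively. Finally all empty nodes are deleted; the $m$-ary search tree consists of the nodes containing at least one key. Each node is labelled by its number of keys in $\{1,\dots,m-1\}$, and children carry their positions in $\{1,\dots,m\}$. The random $m$-ary search tree $T_n$ is obtained from $n$ i.i.d. keys with a continuous distribution (equivalently, a uniformly random permutation of $\{1,\dots,n\}$). Branching process: consider the continuous-time branching process started with one individual at time 0 where all individuals have independent, identically distributed life histories: an individual is born as a node with 1 key; it acquires further keys after successive waiting times $Y_2,\dots,Y_{m-1}$, $Y_i\sim\mathrm{Exp}(i)$ (rate $i$), so that it has $m-1$ keys at age $S=\sum_{i=2}^{m-1}Y_i$; then it gets $m$ children in positions $1,\dots,m$, the child in position $i$ being born at age $S+X_i$, with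 $X_1,\dots,X_m\sim\mathrm{Exp}(1)$; all $Y_i$ and $X_j$ are independent. Let $\mathcal T_t$ be the family tree at time $t$, with nodes labelled by their current number of keys. The asymptotic fringe tree is $\overline{\mathcal T}:=\mathcal T_{\overline\tau}$, where $\overline\tau\sim\mathrm{Exp}(1)$ is independent of the branching process. (It is the limit in distribution, as $n\to\infty$, of the subtree of $T_n$ rooted at a uniformly random node.) *)

theory Defs
  imports "HOL-Probability.Probability"
begin

text \<open>
  Positions are Ulam--Harris words: \<open>[]\<close> is the root and \<open>u @ [i]\<close> is the \<open>i\<close>-th child of \<open>u\<close>.
  A labelled tree is a partial map whose domain is the set of nodes and whose values are the labels.
\<close>

type_synonym ltree = "nat list \<rightharpoonup> nat"

definition words :: "nat \<Rightarrow> nat list set" where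
  "words m = lists {1..m}"

text \<open>
  The label of a node is its number of keys. If there are infinitely many nodes (a null event for the
  trees considered here) the sum is \<open>0\<close>, so for \<open>k \<ge> 1\<close> the equation \<open>num_keys t = k\<close> says that
  \<open>t\<close> is finite with exactly \<open>k\<close> keys.
\<close>

definition num_keys :: "ltree \<Rightarrow> nat" where
  "num_keys t = (\<Sum>u\<in>dom t. the (t u))"

text \<open>
  The product \<open>\<sigma>\<close>-algebra; every single finite tree is a measurable event.
\<close>

definition tree_space :: "ltree measure" where
  "tree_space = (\<Pi>\<^sub>M u\<in>UNIV. count_space UNIV)"


section \<open>The m-ary search tree\<close>

text \<open>
  The open intervals \<open>J\<^sub>1, \<dots>, J\<^sub>m\<close> into which the \<open>m - 1\<close> distinct keys \<open>ys\<close> divide the real line;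
  for an index outside \<open>{1..m}\<close> the set is empty.
\<close>

definition key_interval :: "real list \<Rightarrow> nat \<Rightarrow> real set" where
  "key_interval ys i = {x. x \<notin> set ys \<and> Suc (card {y \<in> set ys. y < x}) = i}"

text \<open>
  The keys stored in node \<open>u\<close> when the keys \<open>xs\<close> arrive, in this order, at the root.
  Empty nodes, which do not belong to the final tree, are those with \<open>node_keys m xs u = []\<close>.
\<close>

fun node_keys :: "nat \<Rightarrow> real list \<Rightarrow> nat list \<Rightarrow> real list" where
  "node_keys m xs [] = take (m - 1) xs"
| "node_keys m xs (i # u) =
     node_keys m (filter (\<lambda>x. x \<in> key_interval (take (m - 1) xs) i) (drop (m - 1) xs)) u"

definition search_tree :: "nat \<Rightarrow> real list \<Rightarrow> ltree" where
  "search_tree m xs u =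
     (if node_keys m xs u = [] then None else Some (length (node_keys m xs u)))"

text \<open>
  The law of \<open>T\<^sub>n\<close>, built from \<open>n\<close> i.i.d. keys with distribution \<open>\<mu>\<close>.
\<close>

definition random_search_tree :: "nat \<Rightarrow> real measure \<Rightarrow> nat \<Rightarrow> ltree measure" where
  "random_search_tree m \<mu> n =
     distr (\<Pi>\<^sub>M i\<in>{..<n}. \<mu>) tree_space (\<lambda>x. search_tree m (map x [0..<n]))"


section \<open>The branching process\<close>

text \<open>
  Indices of the random times: \<open>Key_Wait u i\<close> is the time \<open>Y\<^sub>i\<close> that individual \<open>u\<close> waits between its
  keys \<open>i - 1\<close> and \<open>i\<close>, \<open>Child_Wait u i\<close> is the time \<open>X\<^sub>i\<close> from the moment \<open>u\<close> is full to the birth of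
  its \<open>i\<close>-th child, and \<open>Sampling\<close> is the time at which the whole process is observed.
\<close>

datatype clock = Key_Wait "nat list" nat | Child_Wait "nat list" nat | Sampling

fun clock_rate :: "clock \<Rightarrow> real" where
  "clock_rate (Key_Wait u i) = real i"
| "clock_rate (Child_Wait u i) = 1"
| "clock_rate Sampling = 1"

definition clocks :: "nat \<Rightarrow> clock set" where
  "clocks m = {Key_Wait u i | u i. u \<in> words m \<and> i \<in> {2..m - 1}}
            \<union> {Child_Wait u i | u i. u \<in> words m \<and> i \<in> {1..m}}
            \<union> {Sampling}"

text \<open>
  The functions below are deterministic functions of a realization \<open>z\<close> of all the clocks.
  \<open>key_age z u j\<close> is the age at which \<open>u\<close> acquires its key number \<open>j\<close>; in particular
  \<open>S = key_age z u (m - 1)\<close>, and \<open>key_age z u 1 = 0\<close> since \<open>u\<close> is born with one key.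
\<close>

definition key_age :: "(clock \<Rightarrow> real) \<Rightarrow> nat list \<Rightarrow> nat \<Rightarrow> real" where
  "key_age z u j = (\<Sum>i = 2..j. z (Key_Wait u i))"

text \<open>
  The birth time of \<open>u\<close> is the sum, over the proper ancestors \<open>take k u\<close> of \<open>u\<close>, of the age at which
  that ancestor gives birth to its child in position \<open>u ! k\<close>.
\<close>

definition birth_time :: "nat \<Rightarrow> (clock \<Rightarrow> real) \<Rightarrow> nat list \<Rightarrow> real" where
  "birth_time m z u =
     (\<Sum>k<length u. key_age z (take k u) (m - 1) + z (Child_Wait (take k u) (u ! k)))"

definition family_tree :: "nat \<Rightarrow> (clock \<Rightarrow> real) \<Rightarrow> real \<Rightarrow> ltree" where
  "family_tree m z t u =
     (if u \<in> words m \<and> birth_time m z u \<le> t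
      then Some (card {j \<in> {1..m - 1}. birth_time m z u + key_age z u j \<le> t})
      else None)"

definition fringe_tree :: "nat \<Rightarrow> (clock \<Rightarrow> real) \<Rightarrow> ltree" where
  "fringe_tree m z = family_tree m z (z Sampling)"

end

theory Submission
  imports Defs "HOL-Combinatorics.Multiset_Permutations"
begin

text \<open>
  A tree with \<open>k\<close> keys has \<open>k + 1\<close> gaps, each of which receives a key at rate 1, so the number of gaps
  is a Yule process. Conditioning on the time at which the root becomes full and using the
  independence of its subtrees, one finds that a given finite tree \<open>t\<close> with \<open>k\<close> keys is the value at
  time \<open>s\<close> of the process started with \<open>i\<close> keys in the root with probability
  \<open>(k choose i) p(t) exp (- (i + 1) s) (1 - exp (- s)) ^ (k - i)\<close>, where \<open>p(t)\<close> is defined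
  recursively and does not depend on \<open>s\<close>. Integrating the case \<open>i = 1\<close> against the density
  \<open>exp (- s)\<close> gives \<open>2 p(t) / ((k + 1) (k + 2))\<close>. On the other hand, among the \<open>k!\<close> orders in which
  \<open>k\<close> given keys may arrive, exactly \<open>k! p(t)\<close> lead to the search tree \<open>t\<close>.
\<close>

section \<open>Finite trees\<close>

text \<open>A node with \<open>j < m - 1\<close> keys has \<open>j + 1\<close> gaps, so it waits
  \<open>Exp(j + 1)\<close> for its next key; an empty child has one gap, whence the births at rate
  1. The factor \<open>(k choose i) exp (- (i + 1) s) (1 - exp (- s)) ^ (k - i)\<close> is therefore
  the negative binomial law of a Yule process started from \<open>i + 1\<close> gaps. A general
  \<open>i\<close> is carried along because the root starts with one key but the subtrees start
  empty. In the final integral the substitution \<open>v = 1 - exp (- s)\<close> gives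
  \<open>k * Beta(k, 3)\<close>. On the counting side, a set of \<open>m - 1\<close> root keys out
  of \<open>k\<close> corresponds to the composition of \<open>k - (m - 1)\<close> formed by its gap
  sizes; there are \<open>k choose (m - 1)\<close> of either, and this is the denominator in the
  recursion for \<open>p(t)\<close>. The obstacle is the way back from clocks to shapes: reading off
  a finite shape from a realization presupposes that almost surely only finitely many nodes are born
  before the sampling time. The proof shows only that clocks compatible with \<open>t\<close>
  produce \<open>t\<close>; as the resulting lower bounds have total mass 1, finiteness comes out as
  a consequence.\<close>

text \<open>
  \<open>Lf j\<close> is a node with \<open>j < m - 1\<close> keys, in particular \<open>Lf 0\<close> is the empty tree, and \<open>Nd ts\<close> is a
  full node, all of whose \<open>m\<close> subtrees are listed, the empty ones included.
\<close>

datatype ktree = Lf nat | Nd "ktree list"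

fun valid :: "nat \<Rightarrow> ktree \<Rightarrow> bool" where
  "valid m (Lf j) \<longleftrightarrow> j < m - 1"
| "valid m (Nd ts) \<longleftrightarrow> length ts = m \<and> (\<forall>t\<in>set ts. valid m t)"

fun nkeys :: "nat \<Rightarrow> ktree \<Rightarrow> nat" where
  "nkeys m (Lf j) = j"
| "nkeys m (Nd ts) = sum_list (map (nkeys m) ts) + (m - 1)"

fun rkeys :: "nat \<Rightarrow> ktree \<Rightarrow> nat" where
  "rkeys m (Lf j) = j"
| "rkeys m (Nd ts) = m - 1"

text \<open>
  The probability of \<open>t\<close> under the law of the search tree with \<open>nkeys m t\<close> keys: the sizes of the
  \<open>m\<close> subtrees of a full root are uniform over all compositions, of which there are
  \<open>nkeys m (Nd ts) choose (m - 1)\<close>.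
\<close>

fun weight :: "nat \<Rightarrow> ktree \<Rightarrow> real" where
  "weight m (Lf j) = 1"
| "weight m (Nd ts) = prod_list (map (weight m) ts) / real (nkeys m (Nd ts) choose (m - 1))"

text \<open>The value 0 stands for the absence of a node, so empty subtrees and words that leave the
  tree are treated alike. Positions of children count from 1 and list indices from 0, hence
  \<open>i - 1\<close>.\<close>

function keys_at :: "nat \<Rightarrow> ktree \<Rightarrow> nat list \<Rightarrow> nat" where
  "keys_at m (Lf j) u = (if u = [] then j else 0)"
| "keys_at m (Nd ts) [] = m - 1"
| "keys_at m (Nd ts) (i # u) = (if i \<in> {1..length ts} then keys_at m (ts ! (i - 1)) u else 0)"
  by pat_completeness auto
termination by (relation "Wellfounded.measure (\<lambda>(m, t, u). length u)") auto

definition ltree_of :: "nat \<Rightarrow> ktree \<Rightarrow> ltree" where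
  "ltree_of m t u = (if keys_at m t u = 0 then None else Some (keys_at m t u))"

lemma rkeys_le: "rkeys m t \<le> nkeys m t"
  by (cases t) auto

lemma weight_pos: "weight m t > 0"
proof (induction t)
  case (Nd ts)
  have "prod_list (map (weight m) ts) > 0"
    using Nd by (induction ts) auto
  then show ?case by simp
qed simp

lemma keys_at_Nil: "keys_at m t [] = rkeys m t"
  by (cases t) auto

text \<open>The label of the root separates the two constructors, since validity gives an
  \<open>Lf\<close> fewer than \<open>m - 1\<close> keys. The subtrees are then recovered from the
  words that begin with \<open>Suc k\<close>.\<close>

lemma keys_at_inj:
  assumes "valid m t" "valid m t'" "keys_at m t = keys_at m t'"
  shows "t = t'"
  using assms
proof (induction t arbitrary: t')
  case (Lf j)
  then show ?case
    using fun_cong[OF Lf.prems(3), of "[]"] by (cases t') (auto simp: keys_at_Nil)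
next
  case (Nd ts)
  show ?case
  proof (cases t')
    case (Lf j)
    then show ?thesis
      using Nd.prems(1,2) fun_cong[OF Nd.prems(3), of "[]"] by simp
  next
    case (Nd ts')
    have "ts ! k = ts' ! k" if k: "k < length ts" for k
    proof (rule Nd.IH)
      show "ts ! k \<in> set ts" "valid m (ts ! k)" "valid m (ts' ! k)"
        using Nd.prems Nd k by auto
      show "keys_at m (ts ! k) = keys_at m (ts' ! k)"
      proof
        fix u
        have "length ts' = length ts" using Nd.prems Nd by simp
        then show "keys_at m (ts ! k) u = keys_at m (ts' ! k) u"
          using fun_cong[OF Nd.prems(3), of "Suc k # u"] k unfolding Nd by simp
      qed
    qed
    then show ?thesis
      using Nd.prems Nd by (auto intro: nth_equalityI)
  qed
qed

lemma ltree_of_inj: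
  assumes "valid m t" "valid m t'" "ltree_of m t = ltree_of m t'"
  shows "t = t'"
proof (rule keys_at_inj[OF assms(1,2)])
  have "keys_at m t u = keys_at m t' u" for u
    using fun_cong[OF assms(3), of u] by (auto simp: ltree_of_def split: if_splits)
  then show "keys_at m t = keys_at m t'" by auto
qed

text \<open>The support for a full root consists of the root, whose label \<open>m - 1\<close> is
  nonzero, and of disjoint shifted copies of the supports for the subtrees.\<close>

lemma keys_at_support:
  assumes m: "m \<ge> 2"
  shows "finite {u. keys_at m t u \<noteq> 0} \<and> (\<Sum>u | keys_at m t u \<noteq> 0. keys_at m t u) = nkeys m t"
proof (induction t)
  case (Lf j)
  have "{u. keys_at m (Lf j) u \<noteq> 0} = (if j = 0 then {} else {[]})" by auto
  then show ?case by (cases "j = 0") simp_all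
next
  case (Nd ts)
  define D where "D k = {u. keys_at m (ts ! k) u \<noteq> 0}" for k
  have fin: "finite (D k)" and sm: "(\<Sum>u\<in>D k. keys_at m (ts ! k) u) = nkeys m (ts ! k)"
    if "k < length ts" for k
    using Nd[of "ts ! k"] that by (auto simp: D_def)
  let ?U = "\<Union>k<length ts. (#) (Suc k) ` D k"
  have eq: "{u. keys_at m (Nd ts) u \<noteq> 0} = {[]} \<union> ?U" (is "?L = ?R")
  proof (rule set_eqI)
    fix u show "u \<in> ?L \<longleftrightarrow> u \<in> ?R"
    proof (cases u)
      case (Cons i v)
      show ?thesis
      proof (cases "i \<in> {1..length ts}")
        case True
        then obtain k where "i = Suc k" "k < length ts" by (cases i) auto
        then show ?thesis using Cons by (auto simp: D_def)
      qed (use Cons in \<open>auto simp: D_def\<close>)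
    qed (use m in auto)
  qed
  have finU: "finite ?U" using fin by auto
  have "(\<Sum>u\<in>?R. keys_at m (Nd ts) u) = nkeys m (Nd ts)"
  proof -
    have "(\<Sum>u\<in>?R. keys_at m (Nd ts) u) = (m - 1) + (\<Sum>u\<in>?U. keys_at m (Nd ts) u)"
      using m finU by (subst sum.union_disjoint) auto
    also have "(\<Sum>u\<in>?U. keys_at m (Nd ts) u) = (\<Sum>k<length ts. \<Sum>u\<in>(#) (Suc k) ` D k. keys_at m (Nd ts) u)"
      by (rule sum.UNION_disjoint) (use fin in auto)
    also have "\<dots> = (\<Sum>k<length ts. nkeys m (ts ! k))"
      using sm by (intro sum.cong refl) (simp add: sum.reindex inj_on_def)
    also have "\<dots> = sum_list (map (nkeys m) ts)"
      by (simp add: sum_list_sum_nth atLeast0LessThan)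
    finally show ?thesis by simp
  qed
  then show ?case unfolding eq using finU by simp
qed

lemma num_keys_ltree_of:
  assumes "m \<ge> 2"
  shows "num_keys (ltree_of m t) = nkeys m t"
proof -
  have "dom (ltree_of m t) = {u. keys_at m t u \<noteq> 0}"
    by (auto simp: ltree_of_def dom_def)
  moreover have "the (ltree_of m t u) = keys_at m t u" if "keys_at m t u \<noteq> 0" for u
    using that by (simp add: ltree_of_def)
  ultimately show ?thesis
    using keys_at_support[of m t] assms by (simp add: num_keys_def)
qed

lemma keys_at_outside: "valid m t \<Longrightarrow> u \<notin> words m \<Longrightarrow> keys_at m t u = 0"
proof (induction m t u rule: keys_at.induct)
  case (3 m ts i u)
  then show ?case by (cases "i \<in> {1..m}") (auto simp: words_def)
qed (auto simp: words_def)

section \<open>Search trees of lists of keys\<close>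

text \<open>Recursion on the whole tree in place of \<open>node_keys\<close>, which follows a single
  word. A root with exactly \<open>m - 1\<close> keys is already an \<open>Nd\<close>, with
  \<open>m\<close> empty children. The test \<open>m < 2\<close> secures termination: in the other
  branch at least one key stays in the root.\<close>

function stree :: "nat \<Rightarrow> real list \<Rightarrow> ktree" where
  "stree m xs =
     (if m < 2 \<or> length xs < m - 1 then Lf (length xs)
      else Nd (map (\<lambda>k. stree m (filter (\<lambda>x. x \<in> key_interval (take (m - 1) xs) (Suc k)) (drop (m - 1) xs))) [0..<m]))"
  by auto
termination
proof (relation "Wellfounded.measure (\<lambda>(m, xs). length xs)", goal_cases)
  case (2 m xs k)
  have "length (filter (\<lambda>x. x \<in> key_interval (take (m - 1) xs) (Suc k)) (drop (m - 1) xs)) \<le> length xs - (m - 1)"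
    by (metis length_drop length_filter_le)
  moreover have "length xs - (m - 1) < length xs" using 2 by auto
  ultimately show ?case by simp
qed simp

declare stree.simps[simp del]

lemma valid_stree: "m \<ge> 2 \<Longrightarrow> valid m (stree m xs)"
proof (induction m xs rule: stree.induct)
  case (1 m xs)
  show ?case
  proof (cases "length xs < m - 1")
    case True
    then show ?thesis by (subst stree.simps) simp
  next
    case False
    then have *: "\<not> (m < 2 \<or> length xs < m - 1)" using 1(2) by simp
    show ?thesis
      using 1(1)[OF *] * by (subst stree.simps) simp
  qed
qed

lemma node_keys_Nil: "node_keys m [] u = []"
  by (induction u) auto

lemma key_interval_empty:
  assumes "i \<notin> {1..Suc (length ys)}"
  shows "key_interval ys i = {}"
proof -
  have "card {y \<in> set ys. y < x} \<le> length ys" for x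
    by (rule order_trans[OF card_mono card_length]) auto
  then have "Suc (card {y \<in> set ys. y < x}) \<in> {1..Suc (length ys)}" for x
    by simp
  then show ?thesis
    using assms by (auto simp only: key_interval_def)
qed

text \<open>\<open>node_keys\<close> may descend along any word. At a position outside
  \<open>{1..m}\<close> the key interval is empty, which agrees with the default value 0 of
  \<open>keys_at\<close>.\<close>

lemma length_node_keys:
  assumes "m \<ge> 2"
  shows "length (node_keys m xs u) = keys_at m (stree m xs) u"
proof (induction u arbitrary: xs)
  case Nil
  show ?case using assms by (subst stree.simps) auto
next
  case (Cons i u)
  show ?case
  proof (cases "length xs < m - 1")
    case True
    then show ?thesis by (subst stree.simps) (simp add: node_keys_Nil)
  next
    case False
    show ?thesis
    proof (cases "i \<in> {1..m}")
      case True
      then obtain k where "i = Suc k" "k < m" by (cases i) auto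
      then show ?thesis using False assms Cons by (subst stree.simps) simp
    next
      case i: False
      then have "key_interval (take (m - 1) xs) i = {}"
        using False assms by (intro key_interval_empty) auto
      then show ?thesis using False assms i by (subst stree.simps) (auto simp: node_keys_Nil)
    qed
  qed
qed

lemma search_tree_eq: "m \<ge> 2 \<Longrightarrow> search_tree m xs = ltree_of m (stree m xs)"
  by (auto simp: search_tree_def ltree_of_def fun_eq_iff simp flip: length_node_keys)

section \<open>Gaps between the root keys and their sizes\<close>

definition gap :: "real set \<Rightarrow> real set \<Rightarrow> nat \<Rightarrow> real set" where
  "gap A Y k = {x \<in> A - Y. card {y \<in> Y. y < x} = k}"

lemma gap_partition:
  assumes "finite Y"
  shows "(\<Union>k\<le>card Y. gap A Y k) = A - Y"
proof -
  have "card {y \<in> Y. y < x} \<le> card Y" for x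
    by (rule card_mono) (use assms in auto)
  then show ?thesis by (auto simp: gap_def)
qed

lemma disjoint_gap: "disjoint_family (gap A Y)"
  by (auto simp: disjoint_family_on_def gap_def)

lemma sum_card_gap:
  assumes "finite A" "Y \<subseteq> A"
  shows "(\<Sum>k\<le>card Y. card (gap A Y k)) = card A - card Y"
proof -
  have fin: "finite Y" using assms finite_subset by auto
  have "(\<Sum>k\<le>card Y. card (gap A Y k)) = card (\<Union>k\<le>card Y. gap A Y k)"
  proof (subst card_UN_disjoint)
    show "\<forall>i\<in>{..card Y}. finite (gap A Y i)" using assms by (auto simp: gap_def)
    show "\<forall>i\<in>{..card Y}. \<forall>j\<in>{..card Y}. i \<noteq> j \<longrightarrow> gap A Y i \<inter> gap A Y j = {}"
      by (auto simp: gap_def)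
  qed simp_all
  also have "\<dots> = card A - card Y"
    using assms fin by (simp add: gap_partition card_Diff_subset)
  finally show ?thesis .
qed

text \<open>
  At the least element \<open>y\<close> of the symmetric difference, the gap that ends at \<open>y\<close> for the set containing
  \<open>y\<close> is strictly larger for the other set.
\<close>

lemma gap_sizes_inj:
  assumes A: "finite A" "Y \<subseteq> A" "Y' \<subseteq> A" and card: "card Y = card Y'"
    and gaps: "\<And>k. k \<le> card Y \<Longrightarrow> card (gap A Y k) = card (gap A Y' k)"
  shows "Y = Y'"
proof (rule ccontr)
  assume "Y \<noteq> Y'"
  define D where "D = (Y - Y') \<union> (Y' - Y)"
  have D: "finite D" "D \<noteq> {}" using \<open>Y \<noteq> Y'\<close> A by (auto simp: D_def intro: finite_subset)
  define y where "y = Min D"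
  have y: "y \<in> D" "\<And>x. x < y \<Longrightarrow> x \<in> Y \<longleftrightarrow> x \<in> Y'"
    using Min_in[OF D] Min_le[OF D(1)] by (auto simp: y_def D_def dest: leD)
  have *: False if U: "y \<in> U" "y \<notin> V" "U \<subseteq> A" "V \<subseteq> A" and below: "\<And>x. x < y \<Longrightarrow> x \<in> U \<longleftrightarrow> x \<in> V"
      and c: "\<And>k. k \<le> card U \<Longrightarrow> card (gap A U k) = card (gap A V k)" for U V
  proof -
    have fin: "finite U" "finite V" using U A(1) by (auto intro: finite_subset)
    define k where "k = card {z \<in> U. z < y}"
    have k: "k \<le> card U" unfolding k_def by (rule card_mono) (use fin in auto)
    have keq: "{z \<in> U. z < y} = {z \<in> V. z < y}" using below by auto
    have "insert y (gap A U k) \<subseteq> gap A V k"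
    proof
      fix x assume x: "x \<in> insert y (gap A U k)"
      show "x \<in> gap A V k"
      proof (cases "x < y")
        case True
        then have "{z \<in> U. z < x} = {z \<in> V. z < x}" using below by auto
        then show ?thesis using x True below by (auto simp: gap_def)
      next
        case False
        show ?thesis
        proof (cases "x = y")
          case True
          then show ?thesis using U keq by (auto simp: gap_def k_def)
        next
          case nxy: False
          then have "x > y" using False by simp
          \<comment> \<open>Above \<open>y\<close> there are already \<open>Suc k\<close> elements
            of \<open>U\<close> to the left, so the \<open>k\<close>-th gap of \<open>U\<close> has
            no element there.\<close>
          have "insert y {z \<in> U. z < y} \<subseteq> {z \<in> U. z < x}" using U \<open>x > y\<close> by auto
          then have "card (insert y {z \<in> U. z < y}) \<le> card {z \<in> U. z < x}"
            by (rule card_mono[rotated]) (use fin in auto)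
          then have "Suc k \<le> card {z \<in> U. z < x}"
            using fin by (simp add: k_def)
          then show ?thesis using x nxy by (auto simp: gap_def)
        qed
      qed
    qed
    then have "card (insert y (gap A U k)) \<le> card (gap A V k)"
      by (rule card_mono[rotated]) (use A in \<open>auto simp: gap_def\<close>)
    moreover have "y \<notin> gap A U k" using U by (auto simp: gap_def)
    moreover have "finite (gap A U k)" using A by (auto simp: gap_def)
    ultimately show False using c[OF k] by simp
  qed
  show False
  proof (cases "y \<in> Y")
    case True
    then have "y \<notin> Y'" using y by (auto simp: D_def)
    then show False using *[of Y Y'] True A y gaps by auto
  next
    case False
    then have "y \<in> Y'" using y by (auto simp: D_def)
    then show False using *[of Y' Y] False A y gaps card by auto
  qed
qed

text \<open>Surjectivity by counting: sending \<open>Y\<close> to its gap sizes maps the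
  \<open>n\<close>-subsets of \<open>A\<close> injectively into the compositions of
  \<open>card A - n\<close> into \<open>n + 1\<close> parts, and both sets have
  \<open>card A choose n\<close> elements. For a search tree this means that any prescribed subtree
  sizes come from some set of root keys.\<close>

lemma gap_sizes_surj:
  assumes A: "finite A" and c: "length ks = Suc n" "sum_list ks + n = card A"
  obtains Y where "Y \<subseteq> A" "card Y = n" "\<And>k. k \<le> n \<Longrightarrow> card (gap A Y k) = ks ! k"
proof -
  let ?Ys = "{Y. Y \<subseteq> A \<and> card Y = n}"
  let ?L = "{l. length l = Suc n \<and> sum_list l = sum_list ks}"
  let ?f = "\<lambda>Y. map (\<lambda>k. card (gap A Y k)) [0..<Suc n]"
  have inj: "inj_on ?f ?Ys"
  proof (rule inj_onI)
    fix Y Y' assume Y: "Y \<in> ?Ys" "Y' \<in> ?Ys" "?f Y = ?f Y'"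
    then have "card (gap A Y k) = card (gap A Y' k)" if "k \<le> n" for k
      using that by (metis (lifting) add_0 diff_zero le_imp_less_Suc length_upt nth_map nth_upt)
    then show "Y = Y'" using Y A by (intro gap_sizes_inj[of A]) auto
  qed
  have sub: "?f ` ?Ys \<subseteq> ?L"
  proof (rule image_subsetI)
    fix Y assume Y: "Y \<in> ?Ys"
    have "sum_list (?f Y) = (\<Sum>k\<in>{0..<Suc n}. card (gap A Y k))"
      by (subst interv_sum_list_conv_sum_set_nat) simp
    also have "{0..<Suc n} = {..card Y}" using Y by auto
    also have "(\<Sum>k\<in>{..card Y}. card (gap A Y k)) = card A - card Y"
      using Y A by (intro sum_card_gap) auto
    also have "\<dots> = sum_list ks" using Y c by auto
    finally show "?f Y \<in> ?L" by simp
  qed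
  have "card (?f ` ?Ys) = card A choose n"
    using inj n_subsets[OF A] by (simp add: card_image)
  also have "\<dots> = card ?L"
    using c card_length_sum_list[of "Suc n" "sum_list ks"] binomial_symmetric[of n "card A"]
    by (auto simp flip: c(2))
  finally have card: "card (?f ` ?Ys) = card ?L" .
  \<comment> \<open>Positivity yields finiteness, because infinite sets have cardinality 0.\<close>
  have "card ?L > 0"
    using card_length_sum_list[of "Suc n" "sum_list ks"] by simp
  then have "finite ?L" using card_ge_0_finite by blast
  then have "?f ` ?Ys = ?L" using card sub by (intro card_subset_eq)
  then have "ks \<in> ?f ` ?Ys" using c by auto
  then obtain Y where Y: "Y \<subseteq> A" "card Y = n" "ks = ?f Y" by auto
  show thesis
    by (rule that[OF Y(1,2)]) (simp add: Y(3) nth_append less_Suc_eq_le del: upt_Suc)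
qed

text \<open>In a uniformly random order of a disjoint union, the induced orders of the blocks are
  independent and uniform. The induction splits off one block: an order of the union is an order of
  \<open>B a\<close>, an order of the rest and an interleaving of the two. The factorials stand on
  both sides so that the identity can be stated without division in the natural numbers.\<close>

lemma card_filter_permutations:
  assumes "finite I" "\<And>i. i \<in> I \<Longrightarrow> finite (B i)" "disjoint_family_on B I"
    "\<And>i. i \<in> I \<Longrightarrow> S i \<subseteq> permutations_of_set (B i)"
  shows "card {zs \<in> permutations_of_set (\<Union>i\<in>I. B i). \<forall>i\<in>I. filter (\<lambda>x. x \<in> B i) zs \<in> S i} * (\<Prod>i\<in>I. fact (card (B i)))
     = fact (\<Sum>i\<in>I. card (B i)) * (\<Prod>i\<in>I. card (S i))"
  using assms
proof (induction I rule: finite_induct)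
  case empty
  then show ?case by simp
next
  case (insert a I)
  define U where "U = (\<Union>i\<in>I. B i)"
  define C where "C = {zs \<in> permutations_of_set U. \<forall>i\<in>I. filter (\<lambda>x. x \<in> B i) zs \<in> S i}"
  have dis: "B a \<inter> U = {}" using insert by (auto simp: U_def disjoint_family_on_def)
  have disI: "disjoint_family_on B I" using insert by (auto simp: disjoint_family_on_def)
  have IH: "card C * (\<Prod>i\<in>I. fact (card (B i))) = fact (\<Sum>i\<in>I. card (B i)) * (\<Prod>i\<in>I. card (S i))"
    unfolding C_def U_def by (rule insert.IH) (use insert disI in auto)
  have cU: "card U = (\<Sum>i\<in>I. card (B i))"
    unfolding U_def using insert disI by (intro card_UN_disjoint) (auto simp: disjoint_family_on_def)
  have finU: "finite U" using insert by (auto simp: U_def)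
  have Sa: "xs \<in> S a \<Longrightarrow> set xs = B a \<and> distinct xs \<and> length xs = card (B a)" for xs
    using insert.prems(3)[of a] distinct_card[of xs] by (auto simp: permutations_of_set_def)
  have Cp: "ys \<in> C \<Longrightarrow> set ys = U \<and> distinct ys \<and> length ys = card U" for ys
    using distinct_card[of ys] by (auto simp: C_def permutations_of_set_def)
  have finC: "finite C" by (auto simp: C_def)
  have finS: "finite (S a)" using insert.prems(3)[of a] by (auto intro: finite_subset)
  let ?Z = "{zs \<in> permutations_of_set (\<Union>i\<in>insert a I. B i). \<forall>i\<in>insert a I. filter (\<lambda>x. x \<in> B i) zs \<in> S i}"
  have Z: "?Z = (\<Union>(xs, ys) \<in> S a \<times> C. shuffles xs ys)"
  proof (intro equalityI subsetI)
    fix zs assume zs: "zs \<in> ?Z"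
    have un: "(\<Union>i\<in>insert a I. B i) = B a \<union> U" by (auto simp: U_def)
    have "filter (\<lambda>x. x \<in> B i) (filter (\<lambda>x. x \<notin> B a) zs) = filter (\<lambda>x. x \<in> B i) zs" if "i \<in> I" for i
    proof -
      have "B i \<inter> B a = {}" using that insert by (auto simp: disjoint_family_on_def)
      then show ?thesis by (auto intro!: filter_cong)
    qed
    then have "filter (\<lambda>x. x \<notin> B a) zs \<in> C"
      using zs dis unfolding un by (auto simp: C_def permutations_of_set_def)
    then show "zs \<in> (\<Union>(xs, ys) \<in> S a \<times> C. shuffles xs ys)"
      using zs partition_in_shuffles[of zs "\<lambda>x. x \<in> B a"] by auto
  next
    fix zs assume "zs \<in> (\<Union>(xs, ys) \<in> S a \<times> C. shuffles xs ys)"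
    then obtain xs ys where *: "xs \<in> S a" "ys \<in> C" "zs \<in> shuffles xs ys" by auto
    note s = Sa[OF *(1)] Cp[OF *(2)]
    have d: "set xs \<inter> set ys = {}" using s dis by auto
    have f: "filter (\<lambda>x. x \<in> B a) zs = xs" "filter (\<lambda>x. x \<notin> B a) zs = ys"
      using filter_shuffles_disjoint1[OF d *(3)] s by auto
    have "filter (\<lambda>x. x \<in> B i) zs = filter (\<lambda>x. x \<in> B i) ys" if "i \<in> I" for i
    proof -
      have "B i \<inter> B a = {}" using that insert by (auto simp: disjoint_family_on_def)
      then show ?thesis unfolding f(2)[symmetric] by (auto intro!: filter_cong)
    qed
    then show "zs \<in> ?Z"
      using * f s d set_shuffles[OF *(3)] distinct_disjoint_shuffles[OF _ _ d *(3)]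
      by (auto simp: permutations_of_set_def U_def C_def)
  qed
  have "card ?Z = (\<Sum>p\<in>S a \<times> C. card (case p of (xs, ys) \<Rightarrow> shuffles xs ys))"
    unfolding Z
  proof (rule card_UN_disjoint)
    have eq: "xs = xs' \<and> ys = ys'"
      if "xs \<in> S a" "ys \<in> C" "xs' \<in> S a" "ys' \<in> C" "zs \<in> shuffles xs ys" "zs \<in> shuffles xs' ys'"
      for xs ys xs' ys' zs
    proof -
      have "set xs \<inter> set ys = {}" "set xs' \<inter> set ys' = {}" "set xs = B a" "set xs' = B a"
        using Sa[of xs] Sa[of xs'] Cp[of ys] Cp[of ys'] that dis by auto
      then show ?thesis
        using filter_shuffles_disjoint1[of xs ys zs] filter_shuffles_disjoint1[of xs' ys' zs] that by auto
    qed
    show "\<forall>p\<in>S a \<times> C. \<forall>q\<in>S a \<times> C. p \<noteq> q \<longrightarrow>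
       (case p of (xs, ys) \<Rightarrow> shuffles xs ys) \<inter> (case q of (xs, ys) \<Rightarrow> shuffles xs ys) = {}"
    proof (intro ballI impI equals0I)
      fix p q zs
      assume *: "p \<in> S a \<times> C" "q \<in> S a \<times> C" "p \<noteq> q"
        "zs \<in> (case p of (xs, ys) \<Rightarrow> shuffles xs ys) \<inter> (case q of (xs, ys) \<Rightarrow> shuffles xs ys)"
      obtain xs ys xs' ys' where "p = (xs, ys)" "q = (xs', ys')" by (cases p, cases q)
      then show False using * eq[of xs ys xs' ys' zs] by auto
    qed
  qed (use finC finS in auto)
  also have "\<dots> = (\<Sum>p\<in>S a \<times> C. (card (B a) + card U) choose card (B a))"
  proof (rule sum.cong[OF refl], clarify)
    fix xs ys assume "xs \<in> S a" "ys \<in> C"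
    then show "card (shuffles xs ys) = (card (B a) + card U) choose card (B a)"
      using Sa[of xs] Cp[of ys] dis by (subst card_disjoint_shuffles) auto
  qed
  also have "\<dots> = card (S a) * card C * ((card (B a) + card U) choose card (B a))"
    by (simp add: card_cartesian_product)
  finally have c: "card ?Z = card (S a) * card C * ((card (B a) + card U) choose card (B a))" .
  have bf: "fact (card (B a)) * fact (card U) * ((card (B a) + card U) choose card (B a)) = fact (card (B a) + card U)"
    using binomial_fact_lemma[of "card (B a)" "card (B a) + card U"] by simp
  \<comment> \<open>The extra factor \<open>fact (card U)\<close> lets \<open>bf\<close> absorb the
    binomial coefficient without a division; it is cancelled at the end.\<close>
  have "card ?Z * (fact (card (B a)) * (\<Prod>i\<in>I. fact (card (B i)))) * fact (card U)
      = card (S a) * (card C * (\<Prod>i\<in>I. fact (card (B i)))) * fact (card (B a) + card U)"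
    unfolding c by (subst bf[symmetric]) (simp only: ac_simps)
  also have "\<dots> = (fact (card (B a) + card U) * (card (S a) * (\<Prod>i\<in>I. card (S i)))) * fact (card U)"
    unfolding IH cU by (simp add: ac_simps)
  finally show ?case
    using insert.hyps by (simp add: cU del: Union_image_insert UN_insert)
qed

text \<open>A later key equal to a root key would lie in no interval and be lost. For distinct keys
  the gaps account for everything that is not stored in the root.\<close>

lemma nkeys_stree:
  assumes "m \<ge> 2" "distinct xs"
  shows "nkeys m (stree m xs) = length xs"
  using assms
proof (induction m xs rule: stree.induct)
  case (1 m xs)
  show ?case
  proof (cases "length xs < m - 1")
    case True
    then show ?thesis by (subst stree.simps) simp
  next
    case False
    define ys zs where "ys = take (m - 1) xs" and "zs = drop (m - 1) xs"
    define A where "A = set xs"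
    have d: "distinct ys" "distinct zs" "set ys \<inter> set zs = {}" "set ys \<union> set zs = A" "card (set ys) = m - 1"
      using 1(3) False
      by (auto simp: ys_def zs_def A_def set_take_disj_set_drop_if_distinct distinct_card
          simp flip: set_append)
    have zA: "set zs = A - set ys" using d by auto
    have len: "length (filter (\<lambda>x. x \<in> key_interval ys (Suc k)) zs) = card (gap A (set ys) k)" for k
    proof -
      have "set (filter (\<lambda>x. x \<in> key_interval ys (Suc k)) zs) = gap A (set ys) k"
        using zA by (auto simp: key_interval_def gap_def)
      then show ?thesis using d by (metis distinct_card distinct_filter)
    qed
    have IH: "nkeys m (stree m (filter (\<lambda>x. x \<in> key_interval ys (Suc k)) zs)) = card (gap A (set ys) k)"
      if "k < m" for k
      unfolding len[symmetric] unfolding ys_def zs_def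
      using that False 1(2,3) by (intro 1(1)) (auto intro: distinct_drop)
    have "stree m xs = Nd (map (\<lambda>k. stree m (filter (\<lambda>x. x \<in> key_interval ys (Suc k)) zs)) [0..<m])"
      using False 1(2) by (subst stree.simps) (simp add: ys_def zs_def)
    then have "nkeys m (stree m xs) = (\<Sum>k\<in>{0..<m}. card (gap A (set ys) k)) + (m - 1)"
      using IH by (simp add: o_def interv_sum_list_conv_sum_set_nat)
    also have "{0..<m} = {..card (set ys)}" using d 1(2) by auto
    also have "(\<Sum>k\<in>{..card (set ys)}. card (gap A (set ys) k)) = card A - card (set ys)"
      using d by (intro sum_card_gap) (auto simp: A_def)
    also have "card A = length xs" using 1(3) by (simp add: A_def distinct_card)
    finally show ?thesis using d False by simp
  qed
qed

text \<open>The subtree sizes determine the set \<open>Y\<close> of root keys. An arrival order that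
  leads to \<open>t\<close> is thus one of the \<open>fact n\<close> orders of \<open>Y\<close>,
  followed by an order of \<open>A - Y\<close> whose restriction to each gap leads to the right
  subtree. Dividing \<open>fact n * fact (card A - n)\<close> by \<open>fact (card A)\<close>
  produces the binomial coefficient in \<open>weight\<close>.\<close>

theorem card_stree:
  assumes m: "m \<ge> 2" and "valid m t" "finite A" "nkeys m t = card A"
  shows "real (card {xs \<in> permutations_of_set A. stree m xs = t}) = fact (card A) * weight m t"
  using assms(2-)
proof (induction t arbitrary: A)
  case (Lf j)
  have "{xs \<in> permutations_of_set A. stree m xs = Lf j} = permutations_of_set A"
    using Lf m by (auto simp: permutations_of_set_def distinct_card stree.simps)
  then show ?case using Lf by simp
next
  case (Nd ts)
  define n where "n = m - 1"
  have mn: "m = Suc n" using m by (simp add: n_def)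
  define ks where "ks = map (nkeys m) ts"
  have len: "length ts = m" using Nd by simp
  have "sum_list ks + n = card A" using Nd by (simp add: ks_def n_def)
  then obtain Y where Y: "Y \<subseteq> A" "card Y = n" and gapY: "\<And>k. k \<le> n \<Longrightarrow> card (gap A Y k) = ks ! k"
    using gap_sizes_surj[of A ks n] Nd len by (auto simp: ks_def mn)
  have finY: "finite Y" using Y Nd finite_subset by auto
  define S where "S k = {xs \<in> permutations_of_set (gap A Y k). stree m xs = ts ! k}" for k
  define Z where "Z = {zs \<in> permutations_of_set (A - Y). \<forall>k\<in>{..n}. filter (\<lambda>x. x \<in> gap A Y k) zs \<in> S k}"
  have fin: "finite (gap A Y k)" for k using Nd by (auto simp: gap_def)
  have S: "real (card (S k)) = fact (card (gap A Y k)) * weight m (ts ! k)" if "k \<le> n" for k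
    unfolding S_def using that len Nd.prems mn fin gapY[OF that]
    by (intro Nd.IH) (auto simp: ks_def)
  have filt: "filter (\<lambda>x. x \<in> key_interval ys (Suc k)) zs = filter (\<lambda>x. x \<in> gap A (set ys) k) zs"
    if "set zs = A - set ys" for ys zs k
    using that by (intro filter_cong) (auto simp: key_interval_def gap_def)
  have filt_perm: "filter (\<lambda>x. x \<in> gap A Y k) zs \<in> permutations_of_set (gap A Y k)"
    if "zs \<in> permutations_of_set (A - Y)" for zs k
    using that by (auto simp: permutations_of_set_def gap_def)
  have tsn: "ts = map f [0..<m] \<longleftrightarrow> (\<forall>k\<in>{..n}. f k = ts ! k)" for f
    using len mn by (auto simp: list_eq_iff_nth_eq simp del: upt_Suc)
  have eq: "{xs \<in> permutations_of_set A. stree m xs = Nd ts} = (\<lambda>(ys, zs). ys @ zs) ` (permutations_of_set Y \<times> Z)"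
    (is "?L = ?R")
  proof (intro equalityI subsetI)
    fix xs assume xs: "xs \<in> ?L"
    then have l: "\<not> length xs < m - 1" using m by (auto simp: stree.simps)
    define ys zs where "ys = take n xs" and "zs = drop n xs"
    have d: "distinct xs" "set xs = A" using xs by (auto simp: permutations_of_set_def)
    have app: "xs = ys @ zs" by (simp add: ys_def zs_def)
    have d': "distinct ys" "distinct zs" "set zs = A - set ys" "set ys \<subseteq> A"
      using d unfolding app by auto
    have cY: "card (set ys) = n" using d' l by (simp add: distinct_card ys_def n_def)
    have st: "stree m (filter (\<lambda>x. x \<in> gap A (set ys) k) zs) = ts ! k" if "k \<le> n" for k
    proof -
      have "stree m xs = Nd (map (\<lambda>k. stree m (filter (\<lambda>x. x \<in> key_interval ys (Suc k)) zs)) [0..<m])"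
        using l m by (subst stree.simps) (simp add: ys_def zs_def n_def)
      then have "ts = map (\<lambda>k. stree m (filter (\<lambda>x. x \<in> gap A (set ys) k) zs)) [0..<m]"
        using xs filt[OF d'(3)] by simp
      then show ?thesis using that tsn by auto
    qed
    \<comment> \<open>The number of keys in each subtree is visible in \<open>ts\<close>, so the gap
      sizes of the actual root keys are the prescribed ones, and gap sizes determine the
      set.\<close>
    have "set ys = Y"
    proof (rule gap_sizes_inj[of A])
      fix k assume "k \<le> card (set ys)"
      then have k: "k \<le> n" using cY by simp
      have "set (filter (\<lambda>x. x \<in> gap A (set ys) k) zs) = gap A (set ys) k"
        using d' by (auto simp: gap_def)
      then have "card (gap A (set ys) k) = length (filter (\<lambda>x. x \<in> gap A (set ys) k) zs)"
        using d' by (metis distinct_card distinct_filter)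
      also have "\<dots> = nkeys m (ts ! k)"
        using nkeys_stree[of m "filter (\<lambda>x. x \<in> gap A (set ys) k) zs"] st[OF k] d' m by simp
      also have "\<dots> = card (gap A Y k)"
        using gapY[OF k] k len mn by (simp add: ks_def)
      finally show "card (gap A (set ys) k) = card (gap A Y k)" .
    qed (use Nd d' cY Y in auto)
    then have "ys \<in> permutations_of_set Y" "zs \<in> permutations_of_set (A - Y)"
      using d' by (auto simp: permutations_of_set_def)
    then have "(ys, zs) \<in> permutations_of_set Y \<times> Z"
      using st filt_perm \<open>set ys = Y\<close> by (auto simp: Z_def S_def)
    then show "xs \<in> ?R" unfolding app by (intro image_eqI[of _ _ "(ys, zs)"]) auto
  next
    fix xs assume "xs \<in> ?R"
    then obtain ys zs where *: "ys \<in> permutations_of_set Y" "zs \<in> Z" "xs = ys @ zs" by auto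
    have s: "set ys = Y" "distinct ys" "set zs = A - Y" "distinct zs"
      using * by (auto simp: Z_def permutations_of_set_def)
    have ly: "length ys = n" using s Y by (metis distinct_card)
    have "stree m xs = Nd (map (\<lambda>k. stree m (filter (\<lambda>x. x \<in> key_interval ys (Suc k)) zs)) [0..<m])"
      using m ly * by (subst stree.simps) (simp add: n_def)
    also have "\<dots> = Nd ts"
      using tsn[of "\<lambda>k. stree m (filter (\<lambda>x. x \<in> key_interval ys (Suc k)) zs)"] filt[of zs ys] s *
      by (auto simp: Z_def S_def)
    finally show "xs \<in> ?L"
      using s * Y by (auto simp: permutations_of_set_def)
  qed
  have inj: "inj_on (\<lambda>(ys, zs). ys @ zs) (permutations_of_set Y \<times> Z)"
  proof (rule inj_onI, clarify)
    fix ys zs ys' zs'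
    assume "ys \<in> permutations_of_set Y" "ys' \<in> permutations_of_set Y" and eq: "ys @ zs = ys' @ zs'"
    then have "length ys = length ys'"
      by (metis distinct_card permutations_of_setD)
    then show "ys = ys' \<and> zs = zs'" using eq by simp
  qed
  have card1: "card ?L = fact n * card Z"
    unfolding eq using Y finY inj by (simp add: card_image card_cartesian_product)
  have UN: "(\<Union>k\<in>{..n}. gap A Y k) = A - Y" using gap_partition[OF finY, of A] Y by simp
  have sumg: "(\<Sum>k\<in>{..n}. card (gap A Y k)) = card A - n"
    using sum_card_gap[of A Y] Nd Y by simp
  have "card Z * (\<Prod>k\<in>{..n}. fact (card (gap A Y k))) = fact (card A - n) * (\<Prod>k\<in>{..n}. card (S k))"
    unfolding Z_def sumg[symmetric] UN[symmetric]
    by (rule card_filter_permutations)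
      (use fin disjoint_gap[of A Y] in \<open>auto simp: S_def disjoint_family_on_def\<close>)
  from arg_cong[OF this, of real] have "real (card Z) * (\<Prod>k\<in>{..n}. fact (card (gap A Y k)))
      = fact (card A - n) * (\<Prod>k\<in>{..n}. real (card (S k)))"
    by simp
  also have "(\<Prod>k\<in>{..n}. real (card (S k))) = (\<Prod>k\<in>{..n}. fact (card (gap A Y k))) * (\<Prod>k\<in>{..n}. weight m (ts ! k))"
    using S by (simp add: prod.distrib)
  finally have cZ: "real (card Z) = fact (card A - n) * (\<Prod>k\<in>{..n}. weight m (ts ! k))"
    by (simp add: prod_zero_iff)
  have pr: "(\<Prod>k\<in>{..n}. weight m (ts ! k)) = prod_list (map (weight m) ts)"
    using len mn by (simp add: prod.list_conv_set_nth atLeast0LessThan lessThan_Suc_atMost)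
  have nA: "n \<le> card A" using Y Nd by (metis card_mono)
  have bin: "fact n * fact (card A - n) * real (card A choose n) = fact (card A)"
    using binomial_fact_lemma[OF nA] by (metis of_nat_fact of_nat_mult)
  have ch: "nkeys m (Nd ts) choose (m - 1) = card A choose n" using Nd by (simp add: n_def)
  have "real (card ?L) = fact n * fact (card A - n) * prod_list (map (weight m) ts)"
    unfolding card1 by (simp add: cZ pr)
  also have "\<dots> = fact (card A) * weight m (Nd ts)"
    unfolding weight.simps ch using nA bin by (simp add: field_simps)
  finally show ?case .
qed

section \<open>The law of the search tree with a given number of keys\<close>

definition trees :: "nat \<Rightarrow> nat \<Rightarrow> ktree set" where
  "trees m k = {t. valid m t \<and> nkeys m t = k}"

text \<open>The common value to which both sides of the theorem are reduced: it mentions neither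
  keys nor times.\<close>

definition tree_prob :: "nat \<Rightarrow> nat \<Rightarrow> ltree set \<Rightarrow> real" where
  "tree_prob m k B = (\<Sum>t | t \<in> trees m k \<and> ltree_of m t \<in> B. weight m t)"

text \<open>Weights are positive, so every valid shape of the right size is reached by some arrival
  order. This also shows that there are only finitely many such shapes.\<close>

lemma trees_eq_image:
  assumes "m \<ge> 2" "finite A" "card A = k"
  shows "trees m k = stree m ` permutations_of_set A"
proof (intro equalityI subsetI)
  fix t assume "t \<in> trees m k"
  then have "real (card {xs \<in> permutations_of_set A. stree m xs = t}) = fact k * weight m t"
    using card_stree[of m t A] assms by (auto simp: trees_def)
  also have "\<dots> > 0" by (simp add: weight_pos)
  finally have "{xs \<in> permutations_of_set A. stree m xs = t} \<noteq> {}"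
    by (metis card.empty less_irrefl of_nat_0)
  then show "t \<in> stree m ` permutations_of_set A" by auto
next
  fix t assume "t \<in> stree m ` permutations_of_set A"
  then show "t \<in> trees m k"
    using assms by (auto simp: trees_def valid_stree nkeys_stree permutations_of_set_def distinct_card)
qed

lemma finite_trees:
  assumes "m \<ge> 2"
  shows "finite (trees m k)"
proof -
  have "card (real ` {..<k}) = k" by (simp add: card_image)
  then have "trees m k = stree m ` permutations_of_set (real ` {..<k})"
    using assms by (intro trees_eq_image) auto
  then show ?thesis by simp
qed

lemma card_search_tree:
  assumes "m \<ge> 2" "finite A" "card A = k"
  shows "real (card {xs \<in> permutations_of_set A. search_tree m xs \<in> B}) = fact k * tree_prob m k B"
proof -
  let ?T = "{t. t \<in> trees m k \<and> ltree_of m t \<in> B}"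
  have "{xs \<in> permutations_of_set A. search_tree m xs \<in> B}
      = (\<Union>t\<in>?T. {xs \<in> permutations_of_set A. stree m xs = t})"
    using trees_eq_image[OF assms] assms by (auto simp: search_tree_eq)
  also have "card \<dots> = (\<Sum>t\<in>?T. card {xs \<in> permutations_of_set A. stree m xs = t})"
    using finite_trees[OF assms(1), of k] by (intro card_UN_disjoint) auto
  also have "real \<dots> = (\<Sum>t\<in>?T. fact k * weight m t)"
    using assms by (simp, intro sum.cong refl) (auto simp: trees_def card_stree)
  finally show ?thesis
    by (simp add: tree_prob_def sum_distrib_left)
qed

text \<open>Each of the \<open>fact k\<close> arrival orders leads to exactly one tree, so the
  weights must sum to 1; no direct summation over the recursion is involved. The keys are simply the
  first \<open>k\<close> natural numbers.\<close>

lemma tree_prob_UNIV: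
  assumes "m \<ge> 2"
  shows "tree_prob m k UNIV = 1"
proof -
  have "card (real ` {..<k}) = k" by (simp add: card_image)
  then show ?thesis
    using card_search_tree[OF assms, of "real ` {..<k}" k UNIV] by simp
qed

lemma tree_prob_Compl:
  assumes "m \<ge> 2"
  shows "tree_prob m k B + tree_prob m k (- B) = 1"
proof -
  have "tree_prob m k B + tree_prob m k (- B) = tree_prob m k UNIV"
    unfolding tree_prob_def using finite_trees[OF assms, of k]
    by (subst sum.union_disjoint[symmetric]) (auto intro!: sum.cong)
  then show ?thesis using tree_prob_UNIV[OF assms] by simp
qed

section \<open>I.i.d. keys\<close>

text \<open>Records the positions of the keys in the sample in place of their values. Lists of
  positions form a countable set, so they can be handled as discrete random variables.\<close>

fun node_idx :: "nat \<Rightarrow> (nat \<Rightarrow> real) \<Rightarrow> nat list \<Rightarrow> nat list \<Rightarrow> nat list" where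
  "node_idx m x js [] = take (m - 1) js"
| "node_idx m x js (i # u) =
     node_idx m x (filter (\<lambda>j. x j \<in> key_interval (map x (take (m - 1) js)) i) (drop (m - 1) js)) u"

lemma node_keys_map: "node_keys m (map x js) u = map x (node_idx m x js u)"
  by (induction m x js u rule: node_idx.induct) (auto simp: take_map drop_map filter_map o_def)

section \<open>Measurability of the search tree as a function of the keys\<close>

lemma measurable_card_less:
  fixes N :: "(nat \<Rightarrow> real) measure"
  assumes [measurable]: "\<And>j. j \<in> I \<Longrightarrow> (\<lambda>x. x j) \<in> borel_measurable N"
    and "set as \<subseteq> I" and j: "j \<in> I"
  shows "(\<lambda>x. card {y \<in> set (map x as). y < x j}) \<in> measurable N (count_space UNIV)"
  using assms(2)
proof (induction as)
  case (Cons a as)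
  have [measurable]: "a \<in> I" "j \<in> I" "\<And>b. b \<in> set as \<Longrightarrow> b \<in> I" using Cons j by auto
  have IH[measurable]: "(\<lambda>x. card {y \<in> set (map x as). y < x j}) \<in> measurable N (count_space UNIV)"
    using Cons by simp
  \<comment> \<open>Repeated values are counted once, so \<open>x a\<close> adds to the count only
    if no later entry of the list equals it.\<close>
  have eq: "card {y \<in> set (map x (a # as)). y < x j}
      = (if x a < x j \<and> (\<forall>b\<in>set as. x a \<noteq> x b) then Suc (card {y \<in> set (map x as). y < x j})
         else card {y \<in> set (map x as). y < x j})" for x
  proof -
    have "{y \<in> set (map x (a # as)). y < x j}
       = (if x a < x j then insert (x a) {y \<in> set (map x as). y < x j} else {y \<in> set (map x as). y < x j})"
      by auto
    then show ?thesis by (auto simp: card_insert_if)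
  qed
  have [measurable]: "Measurable.pred N (\<lambda>x. \<forall>b\<in>set as. x a \<noteq> x b)"
    by (rule pred_intros_finite) (use Cons.prems assms(1) in \<open>auto simp: pred_def intro!: borel_measurable_neq\<close>)
  show ?case unfolding eq by measurable
qed simp

lemma pred_key_interval:
  fixes N :: "(nat \<Rightarrow> real) measure"
  assumes [measurable]: "\<And>j. j \<in> I \<Longrightarrow> (\<lambda>x. x j) \<in> borel_measurable N"
    and as: "set as \<subseteq> I" and j[measurable]: "j \<in> I"
  shows "Measurable.pred N (\<lambda>x. x j \<in> key_interval (map x as) i)"
proof -
  have [measurable]: "(\<lambda>x. card {y \<in> set (map x as). y < x j}) \<in> measurable N (count_space UNIV)"
    by (rule measurable_card_less[OF assms])
  have [measurable]: "Measurable.pred N (\<lambda>x. \<forall>b\<in>set as. x j \<noteq> x b)"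
    by (rule pred_intros_finite) (use as assms(1) j in \<open>auto simp: pred_def intro!: borel_measurable_neq\<close>)
  have "x j \<in> key_interval (map x as) i \<longleftrightarrow>
     (\<forall>b\<in>set as. x j \<noteq> x b) \<and> Suc (card {y \<in> set (map x as). y < x j}) = i" for x
    by (auto simp: key_interval_def)
  then show ?thesis by (simp only:) measurable
qed

lemma measurable_filter_list:
  assumes "\<And>j. j \<in> set l \<Longrightarrow> Measurable.pred N (\<lambda>x. P x j)"
  shows "(\<lambda>x. filter (P x) l) \<in> measurable N (count_space (UNIV :: 'b list set))"
  using assms
proof (induction l)
  case (Cons a l)
  have Pa: "{x \<in> space N. P x a} \<in> sets N"
    and Pl: "(\<lambda>x. filter (P x) l) \<in> measurable N (count_space UNIV)"
    using Cons by (auto simp: pred_def)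
  have "(\<lambda>x. a # filter (P x) l) \<in> measurable N (count_space UNIV)"
    by (rule measurable_compose[OF Pl]) simp
  then show ?case using Pa Pl unfolding filter.simps by (intro measurable_If)
qed simp

lemma measurable_node_idx:
  fixes N :: "(nat \<Rightarrow> real) measure"
  assumes meas: "\<And>j. j \<in> I \<Longrightarrow> (\<lambda>x. x j) \<in> borel_measurable N"
    and js: "set js \<subseteq> I"
  shows "(\<lambda>x. node_idx m x js u) \<in> measurable N (count_space UNIV)"
  using js
proof (induction u arbitrary: js)
  case (Cons i u)
  let ?F = "\<lambda>x. filter (\<lambda>j. x j \<in> key_interval (map x (take (m - 1) js)) i) (drop (m - 1) js)"
  have js': "set (take (m - 1) js) \<subseteq> I" "set (drop (m - 1) js) \<subseteq> I"
    using Cons.prems set_take_subset[of "m - 1" js] set_drop_subset[of "m - 1" js] by auto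
  have F: "?F \<in> measurable N (count_space UNIV)"
    by (rule measurable_filter_list) (use js' in \<open>auto intro!: pred_key_interval[OF meas]\<close>)
  \<comment> \<open>The recursive call has a random list as argument, and countability allows it to
    be frozen at each value \<open>l\<close>. Cutting \<open>l\<close> down to \<open>I\<close>
    makes the induction hypothesis available for every \<open>l\<close>; the lists that do occur are
    left unchanged.\<close>
  define G where "G l x = node_idx m x (filter (\<lambda>j. j \<in> I) l) u" for l x
  have G: "G l \<in> measurable N (count_space UNIV)" for l
    unfolding G_def by (rule Cons.IH) auto
  have "(\<lambda>x. G (?F x) x) \<in> measurable N (count_space UNIV)"
    by (rule measurable_compose_countable[OF G F])
  moreover have "filter (\<lambda>j. j \<in> I) (?F x) = ?F x" for x
    by (rule filter_True) (use js' in auto)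
  ultimately show ?case by (simp add: G_def)
qed simp

lemma space_tree_space [simp]: "space tree_space = UNIV"
  by (simp add: tree_space_def space_PiM)

lemma measurable_tree_spaceI:
  assumes "\<And>u. (\<lambda>x. f x u) \<in> measurable N (count_space UNIV)"
  shows "f \<in> measurable N tree_space"
  unfolding tree_space_def using measurable_PiM_single'[of UNIV "\<lambda>u x. f x u" N "\<lambda>_. count_space UNIV"] assms
  by simp

lemma measurable_search_tree:
  fixes N :: "(nat \<Rightarrow> real) measure"
  assumes meas: "\<And>j. j < n \<Longrightarrow> (\<lambda>x. x j) \<in> borel_measurable N"
  shows "(\<lambda>x. search_tree m (map x [0..<n])) \<in> measurable N tree_space"
proof (rule measurable_tree_spaceI)
  fix u
  have [measurable]: "(\<lambda>x. node_idx m x [0..<n] u) \<in> measurable N (count_space UNIV)"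
    by (rule measurable_node_idx[of "{..<n}"]) (use meas in auto)
  show "(\<lambda>x. search_tree m (map x [0..<n]) u) \<in> measurable N (count_space UNIV)"
    unfolding search_tree_def node_keys_map length_map map_is_Nil_conv by measurable
qed

text \<open>A continuous distribution function excludes atoms, so by Fubini the diagonal is a null
  set for the joint law of two independent coordinates; there are finitely many pairs of
  coordinates.\<close>

lemma AE_inj_on_PiM:
  assumes \<mu>: "real_distribution \<mu>" and cont: "continuous_on UNIV (cdf \<mu>)"
  shows "AE x in (\<Pi>\<^sub>M i\<in>{..<n::nat}. \<mu>). inj_on x {..<n}"
proof -
  interpret \<mu>: real_distribution \<mu> by fact
  let ?P = "\<Pi>\<^sub>M i\<in>{..<n}. \<mu>"
  interpret PP: prob_space ?P by (intro prob_space_PiM \<mu>.prob_space_axioms)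
  have sing: "measure \<mu> {a} = 0" for a
    using cont \<mu>.isCont_cdf[of a] by (auto simp: continuous_on_eq_continuous_at)
  have "AE x in ?P. x i \<noteq> x j" if ij: "i < n" "j < n" "i \<noteq> j" for i j
  proof -
    have ind: "PP.indep_vars (\<lambda>_. \<mu>) (\<lambda>i x. x i) {..<n}"
    proof (subst PP.indep_vars_iff_distr_eq_PiM')
      show "distr ?P ?P (\<lambda>x. restrict x {..<n}) = (\<Pi>\<^sub>M i\<in>{..<n}. distr ?P \<mu> (\<lambda>x. x i))"
      proof -
        have "distr ?P ?P (\<lambda>x. restrict x {..<n}) = distr ?P ?P (\<lambda>x. x)"
          by (rule distr_cong) (auto simp: space_PiM)
        also have "\<dots> = ?P" by simp
        also have "\<dots> = (\<Pi>\<^sub>M i\<in>{..<n}. distr ?P \<mu> (\<lambda>x. x i))"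
          by (rule PiM_cong) (simp_all add: distr_PiM_component[OF \<mu>.prob_space_axioms])
        finally show ?thesis .
      qed
    qed (use ij in auto)
    have "PP.indep_var \<mu> (\<lambda>x. x i) \<mu> (\<lambda>x. x j)"
      using PP.indep_var_compose[OF PP.indep_var_restrict[OF ind, of "{i}" "{j}"], of "\<lambda>f. f i" \<mu> "\<lambda>f. f j" \<mu>] ij
      by (simp add: comp_def measurable_component_singleton)
    then have eq: "distr ?P \<mu> (\<lambda>x. x i) \<Otimes>\<^sub>M distr ?P \<mu> (\<lambda>x. x j) = distr ?P (\<mu> \<Otimes>\<^sub>M \<mu>) (\<lambda>x. (x i, x j))"
      by (simp add: PP.indep_var_distribution_eq)
    have comp: "distr ?P \<mu> (\<lambda>x. x l) = \<mu>" if "l < n" for l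
      using distr_PiM_component[of "{..<n}" "\<lambda>_. \<mu>" l] that by (simp add: \<mu>.prob_space_axioms)
    have eq: "distr ?P (\<mu> \<Otimes>\<^sub>M \<mu>) (\<lambda>x. (x i, x j)) = \<mu> \<Otimes>\<^sub>M \<mu>"
      using eq comp ij by simp
    have "AE p in \<mu> \<Otimes>\<^sub>M \<mu>. fst p \<noteq> snd p"
    proof (rule AE_I')
      show "{p \<in> space (\<mu> \<Otimes>\<^sub>M \<mu>). \<not> fst p \<noteq> snd p} \<in> null_sets (\<mu> \<Otimes>\<^sub>M \<mu>)"
      proof -
        have "emeasure (\<mu> \<Otimes>\<^sub>M \<mu>) {p \<in> space (\<mu> \<Otimes>\<^sub>M \<mu>). fst p = snd p}
          = (\<integral>\<^sup>+ a. emeasure \<mu> (Pair a -` {p \<in> space (\<mu> \<Otimes>\<^sub>M \<mu>). fst p = snd p}) \<partial>\<mu>)"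
          by (rule \<mu>.emeasure_pair_measure_alt) measurable
        also have "\<dots> = (\<integral>\<^sup>+ a. 0 \<partial>\<mu>)"
        proof (rule nn_integral_cong)
          fix a assume "a \<in> space \<mu>"
          then have "Pair a -` {p \<in> space (\<mu> \<Otimes>\<^sub>M \<mu>). fst p = snd p} = {a}"
            by (auto simp: space_pair_measure)
          then show "emeasure \<mu> (Pair a -` {p \<in> space (\<mu> \<Otimes>\<^sub>M \<mu>). fst p = snd p}) = 0"
            using sing[of a] by (simp add: \<mu>.emeasure_eq_measure)
        qed
        finally have "emeasure (\<mu> \<Otimes>\<^sub>M \<mu>) {p \<in> space (\<mu> \<Otimes>\<^sub>M \<mu>). fst p = snd p} = 0" by simp
        moreover have "{p \<in> space (\<mu> \<Otimes>\<^sub>M \<mu>). fst p = snd p} \<in> sets (\<mu> \<Otimes>\<^sub>M \<mu>)" by measurable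
        ultimately show ?thesis by (auto intro: null_setsI)
      qed
    qed auto
    then have "AE p in distr ?P (\<mu> \<Otimes>\<^sub>M \<mu>) (\<lambda>x. (x i, x j)). fst p \<noteq> snd p"
      unfolding eq .
    moreover have "{p \<in> space (\<mu> \<Otimes>\<^sub>M \<mu>). fst p \<noteq> snd p} \<in> sets (\<mu> \<Otimes>\<^sub>M \<mu>)" by measurable
    ultimately show ?thesis
      using ij by (subst (asm) AE_distr_iff) (auto simp: measurable_component_singleton)
  qed
  then have "AE x in ?P. \<forall>i\<in>{..<n}. \<forall>j\<in>{..<n}. i \<noteq> j \<longrightarrow> x i \<noteq> x j"
    by (intro AE_finite_allI) auto
  then show ?thesis by eventually_elim (auto simp: inj_on_def)
qed

text \<open>For distinct keys, permuting the indices and ordering the set of values amount to the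
  same thing, so the count of arrival orders applies whatever the observed values are.\<close>

lemma card_permutes_search_tree:
  assumes "m \<ge> 2" "inj_on x {..<n}"
  shows "real (card {\<sigma>. \<sigma> permutes {..<n} \<and> search_tree m (map (\<lambda>i. x (\<sigma> i)) [0..<n]) \<in> B}) = fact n * tree_prob m n B"
proof -
  let ?f = "\<lambda>\<sigma>. map (\<lambda>i. x (\<sigma> i)) [0..<n]"
  let ?S = "{\<sigma>. \<sigma> permutes {..<n}}"
  have inj: "inj_on ?f ?S"
  proof (rule inj_onI)
    fix \<sigma> \<tau> assume *: "\<sigma> \<in> ?S" "\<tau> \<in> ?S" "?f \<sigma> = ?f \<tau>"
    have "\<sigma> i = \<tau> i" for i
    proof (cases "i < n")
      case True
      then have "x (\<sigma> i) = x (\<tau> i)" using * by (auto simp: list_eq_iff_nth_eq)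
      then show ?thesis
        using assms(2) * True permutes_in_image[of \<sigma> "{..<n}" i] permutes_in_image[of \<tau> "{..<n}" i]
        by (auto simp: inj_on_def)
    next
      case False
      then show ?thesis using *(1,2) by (simp add: permutes_not_in)
    qed
    then show "\<sigma> = \<tau>" by auto
  qed
  have cx: "card (x ` {..<n}) = n" using assms by (simp add: card_image)
  have "?f ` ?S \<subseteq> permutations_of_set (x ` {..<n})"
  proof (rule image_subsetI)
    fix \<sigma> assume "\<sigma> \<in> ?S"
    then have \<sigma>: "\<sigma> permutes {..<n}" by simp
    have im: "\<sigma> ` {..<n} = {..<n}" by (rule permutes_image[OF \<sigma>])
    have "inj_on (x \<circ> \<sigma>) {..<n}"
      by (rule comp_inj_on) (use \<sigma> assms im in \<open>auto intro: permutes_inj_on\<close>)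
    then have "distinct (?f \<sigma>)"
      by (simp add: distinct_map atLeast0LessThan o_def)
    moreover have "set (?f \<sigma>) = x ` {..<n}"
      using im by (auto simp: atLeast0LessThan simp flip: image_image)
    ultimately show "?f \<sigma> \<in> permutations_of_set (x ` {..<n})"
      by (auto simp: permutations_of_set_def)
  qed
  then have img: "?f ` ?S = permutations_of_set (x ` {..<n})"
    by (intro card_subset_eq) (auto simp: card_image[OF inj] card_permutations cx)
  have "{xs \<in> permutations_of_set (x ` {..<n}). search_tree m xs \<in> B}
      = ?f ` {\<sigma>. \<sigma> permutes {..<n} \<and> search_tree m (?f \<sigma>) \<in> B}"
    unfolding img[symmetric] by auto
  then have "card {xs \<in> permutations_of_set (x ` {..<n}). search_tree m xs \<in> B}
      = card {\<sigma>. \<sigma> permutes {..<n} \<and> search_tree m (?f \<sigma>) \<in> B}"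
    using inj_on_subset[OF inj] by (simp add: card_image subset_iff)
  then show ?thesis
    using card_search_tree[OF assms(1), of "x ` {..<n}" n B] cx by simp
qed

text \<open>
  Exchangeability: averaging over all rearrangements of the sample turns the probability into a
  count of permutations of the set of the observed keys.
\<close>

lemma emeasure_random_search_tree:
  assumes m: "m \<ge> 2" and \<mu>: "real_distribution \<mu>" and cont: "continuous_on UNIV (cdf \<mu>)"
    and B: "B \<in> sets tree_space"
  shows "emeasure (random_search_tree m \<mu> n) B = ennreal (tree_prob m n B)"
proof -
  interpret \<mu>: real_distribution \<mu> by fact
  let ?P = "\<Pi>\<^sub>M i\<in>{..<n}. \<mu>"
  interpret PP: prob_space ?P by (intro prob_space_PiM \<mu>.prob_space_axioms)
  let ?g = "\<lambda>x. search_tree m (map x [0..<n])"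
  let ?Per = "{\<sigma>. \<sigma> permutes {..<n}}"
  have fin: "finite ?Per" by (simp add: finite_permutations)
  have g[measurable]: "?g \<in> measurable ?P tree_space"
    by (rule measurable_search_tree) (auto simp: measurable_component_singleton \<mu>.M_is_borel)
  let ?E = "{x \<in> space ?P. ?g x \<in> B}"
  have E: "?E \<in> sets ?P" using g B by measurable
  have emE: "emeasure (random_search_tree m \<mu> n) B = emeasure ?P ?E"
    unfolding random_search_tree_def using g B
    by (subst emeasure_distr) (auto intro!: arg_cong2[where f=emeasure])
  let ?s = "\<lambda>\<sigma> x. \<lambda>i\<in>{..<n}. x (\<sigma> i)"
  have s: "?s \<sigma> \<in> measurable ?P ?P" and ds: "distr ?P ?P (?s \<sigma>) = ?P" if "\<sigma> permutes {..<n}" for \<sigma>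
  proof -
    have img: "\<sigma> i < n" if "i < n" for i
      using permutes_in_image[OF \<open>\<sigma> permutes {..<n}\<close>, of i] that by simp
    show "?s \<sigma> \<in> measurable ?P ?P"
      by (rule measurable_restrict) (use img in auto)
    show "distr ?P ?P (?s \<sigma>) = ?P"
      using distr_PiM_reindex[of "{..<n}" "\<lambda>_. \<mu>" \<sigma> "{..<n}"] img that
      by (auto simp: permutes_inj_on \<mu>.prob_space_axioms)
  qed
  have gs: "?g (?s \<sigma> x) = search_tree m (map (\<lambda>i. x (\<sigma> i)) [0..<n])" for \<sigma> x
    by (rule arg_cong[of _ _ "search_tree m"]) auto
  let ?I = "\<lambda>\<sigma> x. indicator B (search_tree m (map (\<lambda>i. x (\<sigma> i)) [0..<n])) :: ennreal"
  have I: "?I \<sigma> \<in> borel_measurable ?P" and Ie: "(\<integral>\<^sup>+ x. ?I \<sigma> x \<partial>?P) = emeasure ?P ?E" if \<sigma>: "\<sigma> \<in> ?Per" for \<sigma>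
  proof -
    have [measurable]: "?s \<sigma> \<in> measurable ?P ?P" using s \<sigma> by simp
    have gi: "(\<lambda>x. indicator B (?g x) :: ennreal) \<in> borel_measurable ?P" using B by measurable
    show "?I \<sigma> \<in> borel_measurable ?P"
      using measurable_compose[OF s gi] \<sigma> unfolding gs by simp
    have "(\<integral>\<^sup>+ x. ?I \<sigma> x \<partial>?P) = (\<integral>\<^sup>+ x. indicator B (?g x) \<partial>distr ?P ?P (?s \<sigma>))"
      using s \<sigma> gi by (subst nn_integral_distr) (auto simp: gs)
    also have "\<dots> = (\<integral>\<^sup>+ x. indicator B (?g x) \<partial>?P)" using ds \<sigma> by simp
    also have "\<dots> = (\<integral>\<^sup>+ x. indicator ?E x \<partial>?P)"
      by (rule nn_integral_cong) (auto simp: indicator_def)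
    also have "\<dots> = emeasure ?P ?E" using E by simp
    finally show "(\<integral>\<^sup>+ x. ?I \<sigma> x \<partial>?P) = emeasure ?P ?E" .
  qed
  have "fact n * emeasure ?P ?E = (\<Sum>\<sigma>\<in>?Per. emeasure ?P ?E)"
    by (simp add: card_permutations)
  also have "\<dots> = (\<Sum>\<sigma>\<in>?Per. \<integral>\<^sup>+ x. ?I \<sigma> x \<partial>?P)"
    by (intro sum.cong refl) (simp only: Ie)
  also have "\<dots> = (\<integral>\<^sup>+ x. (\<Sum>\<sigma>\<in>?Per. ?I \<sigma> x) \<partial>?P)"
    by (rule nn_integral_sum[symmetric]) (rule I)
  \<comment> \<open>For almost every sample the sum counts rearrangements of distinct keys, and this
    count does not depend on the sample: the integrand is almost surely constant.\<close>
  also have "\<dots> = (\<integral>\<^sup>+ x. ennreal (fact n * tree_prob m n B) \<partial>?P)"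
  proof (rule nn_integral_cong_AE)
    show "AE x in ?P. (\<Sum>\<sigma>\<in>?Per. ?I \<sigma> x) = ennreal (fact n * tree_prob m n B)"
      using AE_inj_on_PiM[OF \<mu> cont, of n]
    proof eventually_elim
      case (elim x)
      have "(\<Sum>\<sigma>\<in>?Per. ?I \<sigma> x) = of_nat (card {\<sigma>. \<sigma> permutes {..<n} \<and> search_tree m (map (\<lambda>i. x (\<sigma> i)) [0..<n]) \<in> B})"
        using fin by (auto simp: indicator_def sum.If_cases intro!: arg_cong[where f=card])
      also have "\<dots> = ennreal (fact n * tree_prob m n B)"
        unfolding card_permutes_search_tree[OF m elim, symmetric] by (simp add: ennreal_of_nat_eq_real_of_nat)
      finally show ?case .
    qed
  qed
  also have "\<dots> = ennreal (fact n * tree_prob m n B)"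
    using PP.emeasure_space_1 by simp
  finally have *: "fact n * emeasure ?P ?E = ennreal (fact n * tree_prob m n B)" .
  have "tree_prob m n B \<ge> 0"
    unfolding tree_prob_def by (intro sum_nonneg) (simp add: less_imp_le weight_pos)
  then have "ennreal (fact n * PP.prob ?E) = ennreal (fact n * tree_prob m n B)"
    using * by (simp add: PP.emeasure_eq_measure ennreal_mult flip: ennreal_fact)
  then have "PP.prob ?E = tree_prob m n B"
    using \<open>tree_prob m n B \<ge> 0\<close> by (subst (asm) ennreal_inj) auto
  then show ?thesis unfolding emE by (simp add: PP.emeasure_eq_measure)
qed

section \<open>Probabilities of finite trees in the branching process\<close>

text \<open>
  Up to the factor \<open>(n + j) choose j\<close>, this is the probability that a Yule process with \<open>j + 1\<close>
  individuals (the gaps between \<open>j\<close> keys) has \<open>n\<close> births (new keys) before time \<open>r\<close>.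
\<close>

definition yule :: "nat \<Rightarrow> nat \<Rightarrow> real \<Rightarrow> real" where
  "yule j n r = (if r < 0 then 0 else exp (- (real j + 1) * r) * (1 - exp (- r)) ^ n)"

lemma yule_nonneg: "yule j n r \<ge> 0"
  by (auto simp: yule_def)

lemma measurable_yule [measurable]: "yule j n \<in> borel_measurable borel"
  unfolding yule_def by measurable

text \<open>One step of the gap process: after an \<open>Exp(j + 1)\<close> wait there are
  \<open>j + 2\<close> gaps. Since \<open>yule\<close> vanishes at negative times, the convolution
  runs over \<open>{0..s}\<close>, where the integrand is a constant times
  \<open>exp (- (s - x)) * (1 - exp (- (s - x))) ^ n\<close>, an exact derivative; integrating the
  power gives the denominator \<open>Suc n\<close>.\<close>

lemma nn_integral_exponential_yule:
  assumes "distributed M lborel Y (\<lambda>x. ennreal (exponential_density (real (Suc j)) x))"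
  shows "(\<integral>\<^sup>+ \<omega>. ennreal (yule (Suc j) n (s - Y \<omega>)) \<partial>M)
     = ennreal (real (Suc j) / real (Suc n) * yule j (Suc n) s)"
proof -
  have "(\<integral>\<^sup>+ \<omega>. ennreal (yule (Suc j) n (s - Y \<omega>)) \<partial>M)
      = (\<integral>\<^sup>+ x. ennreal (exponential_density (real (Suc j)) x) * ennreal (yule (Suc j) n (s - x)) \<partial>lborel)"
    by (rule distributed_nn_integral[OF assms, symmetric]) measurable
  also have "\<dots> = ennreal (real (Suc j) / real (Suc n) * yule j (Suc n) s)"
  proof (cases "s < 0")
    case True
    then have "(\<integral>\<^sup>+ x. ennreal (exponential_density (real (Suc j)) x) * ennreal (yule (Suc j) n (s - x)) \<partial>lborel)
        = (\<integral>\<^sup>+ (x::real). 0 \<partial>lborel)"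
      by (intro nn_integral_cong) (auto simp: exponential_density_def yule_def)
    then show ?thesis using True by (simp add: yule_def)
  next
    case False
    let ?c = "real (Suc j) * exp (- (real j + 1) * s)"
    let ?f = "\<lambda>x. ?c * (exp (- (s - x)) * (1 - exp (- (s - x))) ^ n)"
    let ?F = "\<lambda>x. - (?c / real (Suc n) * (1 - exp (- (s - x))) ^ Suc n)"
    have "exponential_density (real (Suc j)) x * yule (Suc j) n (s - x) = ?f x" if "0 \<le> x" "x \<le> s" for x
    proof -
      have "exp (- x * (real j + 1)) * exp (- (real j + 2) * (s - x)) = exp (- (real j + 1) * s) * exp (- (s - x))"
        by (simp add: field_simps flip: exp_add)
      then show ?thesis
        using that by (simp add: exponential_density_def yule_def algebra_simps)
    qed
    then have "(\<integral>\<^sup>+ x. ennreal (exponential_density (real (Suc j)) x) * ennreal (yule (Suc j) n (s - x)) \<partial>lborel)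
       = (\<integral>\<^sup>+ x. ennreal (?f x) * indicator {0..s} x \<partial>lborel)"
      by (intro nn_integral_cong)
        (auto simp: indicator_def yule_nonneg exponential_density_def yule_def simp flip: ennreal_mult')
    also have "\<dots> = ennreal (?F s - ?F 0)"
    proof (rule nn_integral_FTC_Icc[where F = ?F and f = ?f])
      show "?f \<in> borel_measurable borel" by measurable
      fix x assume "x \<in> {0..s}"
      then show "?f x \<ge> 0" by simp
      have "((\<lambda>x. 1 - exp (- (s - x))) has_real_derivative - exp (- (s - x))) (at x)"
        by (auto intro!: derivative_eq_intros)
      note DERIV_minus[OF DERIV_cmult[OF DERIV_power_Suc[OF this, of n], of "?c / real (Suc n)"]]
      then show "(?F has_real_derivative ?f x) (at x)"
        by (rule DERIV_cong) (simp add: field_simps)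
    qed (use False in simp)
    also have "?F s - ?F 0 = real (Suc j) / real (Suc n) * yule j (Suc n) s"
      using False by (simp add: yule_def)
    finally show ?thesis .
  qed
  finally show ?thesis .
qed

section \<open>Conditioning on an independent variable\<close>

lemma indep_var_nn_integral:
  assumes "prob_space M" "prob_space.indep_var M S X T Y"
    and h: "h \<in> borel_measurable (S \<Otimes>\<^sub>M T)"
  shows "(\<integral>\<^sup>+ \<omega>. h (X \<omega>, Y \<omega>) \<partial>M) = (\<integral>\<^sup>+ \<omega>. \<integral>\<^sup>+ \<omega>'. h (X \<omega>, Y \<omega>') \<partial>M \<partial>M)"
proof -
  interpret prob_space M by fact
  have X[measurable]: "X \<in> measurable M S" and Y[measurable]: "Y \<in> measurable M T"
    and eq: "distr M S X \<Otimes>\<^sub>M distr M T Y = distr M (S \<Otimes>\<^sub>M T) (\<lambda>x. (X x, Y x))"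
    using assms(2) unfolding indep_var_distribution_eq by auto
  note h[measurable]
  interpret DY: prob_space "distr M T Y" by (rule prob_space_distr[OF Y])
  have "(\<integral>\<^sup>+ \<omega>. h (X \<omega>, Y \<omega>) \<partial>M) = (\<integral>\<^sup>+ p. h p \<partial>distr M (S \<Otimes>\<^sub>M T) (\<lambda>x. (X x, Y x)))"
    by (subst nn_integral_distr) auto
  also have "\<dots> = (\<integral>\<^sup>+ x. \<integral>\<^sup>+ y. h (x, y) \<partial>distr M T Y \<partial>distr M S X)"
    unfolding eq[symmetric] by (rule DY.nn_integral_fst[symmetric]) (simp add: h)
  also have "\<dots> = (\<integral>\<^sup>+ x. \<integral>\<^sup>+ \<omega>'. h (x, Y \<omega>') \<partial>M \<partial>distr M S X)"
    by (intro nn_integral_cong nn_integral_distr) auto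
  also have "\<dots> = (\<integral>\<^sup>+ \<omega>. \<integral>\<^sup>+ \<omega>'. h (X \<omega>, Y \<omega>') \<partial>M \<partial>M)"
    by (rule nn_integral_distr) measurable
  finally show ?thesis .
qed

lemma emeasure_eq_nn_integral_if:
  assumes "Measurable.pred M Q"
  shows "emeasure M {x \<in> space M. Q x} = (\<integral>\<^sup>+ x. (if Q x then 1 else 0) \<partial>M)"
proof -
  have "(\<integral>\<^sup>+ x. (if Q x then 1 else 0) \<partial>M) = (\<integral>\<^sup>+ x. indicator {x \<in> space M. Q x} x \<partial>M)"
    by (intro nn_integral_cong) (auto simp: indicator_def)
  then show ?thesis using assms by (simp add: pred_def)
qed

lemma indep_var_emeasure:
  assumes "prob_space M" "prob_space.indep_var M S X T Y"
    and P: "Measurable.pred (S \<Otimes>\<^sub>M T) (\<lambda>p. P (fst p) (snd p))"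
  shows "emeasure M {\<omega> \<in> space M. P (X \<omega>) (Y \<omega>)}
    = (\<integral>\<^sup>+ \<omega>. emeasure M {\<omega>' \<in> space M. P (X \<omega>) (Y \<omega>')} \<partial>M)"
proof -
  interpret prob_space M by fact
  have X[measurable]: "X \<in> measurable M S" and Y[measurable]: "Y \<in> measurable M T"
    using assms(2) unfolding indep_var_distribution_eq by auto
  let ?h = "\<lambda>p. if P (fst p) (snd p) then 1 else 0 :: ennreal"
  have h: "?h \<in> borel_measurable (S \<Otimes>\<^sub>M T)"
    using P by measurable
  have m1: "Measurable.pred M (\<lambda>\<omega>. P (X \<omega>) (Y \<omega>))"
    using measurable_compose[of "\<lambda>\<omega>. (X \<omega>, Y \<omega>)" M "S \<Otimes>\<^sub>M T", OF _ P] by simp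
  have m2: "Measurable.pred M (\<lambda>\<omega>'. P (X \<omega>) (Y \<omega>'))" if "\<omega> \<in> space M" for \<omega>
    using measurable_compose[of "\<lambda>\<omega>'. (X \<omega>, Y \<omega>')" M "S \<Otimes>\<^sub>M T", OF _ P] measurable_space[OF X that] by simp
  have "emeasure M {\<omega> \<in> space M. P (X \<omega>) (Y \<omega>)} = (\<integral>\<^sup>+ \<omega>. ?h (X \<omega>, Y \<omega>) \<partial>M)"
    using emeasure_eq_nn_integral_if[OF m1] by simp
  also have "\<dots> = (\<integral>\<^sup>+ \<omega>. \<integral>\<^sup>+ \<omega>'. ?h (X \<omega>, Y \<omega>') \<partial>M \<partial>M)"
    by (rule indep_var_nn_integral[OF assms(1,2) h])
  also have "\<dots> = (\<integral>\<^sup>+ \<omega>. emeasure M {\<omega>' \<in> space M. P (X \<omega>) (Y \<omega>')} \<partial>M)"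
    by (intro nn_integral_cong) (simp add: emeasure_eq_nn_integral_if[OF m2])
  finally show ?thesis .
qed

text \<open>The absorption identity for binomial coefficients, in the form that combines the factor
  \<open>Suc j / Suc n\<close> of one more wait with the ratio obtained for the previous
  waits.\<close>

lemma binomial_ratio_Suc:
  "real (Suc j) / real (Suc n) * (1 / real ((Suc n + j) choose j)) = 1 / real ((n + Suc j) choose Suc j)"
proof -
  have "Suc j * (N choose Suc j) = (N - j) * (N choose j)" for N
    by (simp only: binomial_absorption binomial_absorb_comp)
  from this[of "n + Suc j"] have "Suc j * ((n + Suc j) choose Suc j) = Suc n * ((n + Suc j) choose j)"
    by (simp only: add_Suc_right add_Suc[symmetric] diff_add_inverse2)
  then have "real (Suc j) * real ((n + Suc j) choose Suc j) = real (Suc n) * real ((Suc n + j) choose j)"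
    by (metis add_Suc_right add_Suc_shift of_nat_mult)
  moreover have "real ((n + Suc j) choose Suc j) > 0" "real ((Suc n + j) choose j) > 0" by (simp_all del: binomial_Suc_Suc)
  ultimately show ?thesis
    by (simp add: divide_simps del: of_nat_Suc binomial_Suc_Suc)
qed

text \<open>Integrates out the waits that lead from \<open>i\<close> to \<open>j\<close> keys.
  Removing the last wait lowers \<open>j\<close> by one and raises the number \<open>n\<close> of
  later keys by one, so \<open>n + j\<close> is preserved and \<open>n\<close> has to vary in the
  induction.\<close>

lemma nn_integral_sum_exponential_yule:
  fixes y :: "nat \<Rightarrow> 'a \<Rightarrow> real"
  assumes "prob_space M" "prob_space.indep_vars M (\<lambda>_. borel) y {i<..j}"
    and "\<And>l. l \<in> {i<..j} \<Longrightarrow> distributed M lborel (y l) (\<lambda>x. ennreal (exponential_density (real l) x))"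
    and "i \<le> j"
  shows "(\<integral>\<^sup>+ \<omega>. ennreal (yule j n (s - (\<Sum>l\<in>{i<..j}. y l \<omega>))) \<partial>M)
    = ennreal (real ((n + j) choose i) / real ((n + j) choose j) * yule i (n + j - i) s)"
  using assms(4,2,3)
proof (induction j arbitrary: n rule: dec_induct)
  case base
  interpret prob_space M by fact
  show ?case by (simp add: emeasure_space_1)
next
  case (step j)
  interpret prob_space M by fact
  let ?A = "\<lambda>\<omega>. \<Sum>l\<in>{i<..j}. y l \<omega>"
  have ins: "{i<..Suc j} = insert (Suc j) {i<..j}" using step by auto
  have "indep_var borel ((\<lambda>f. \<Sum>l\<in>{i<..j}. f l) \<circ> (\<lambda>\<omega>. restrict (\<lambda>l. y l \<omega>) {i<..j}))
      borel ((\<lambda>f. f (Suc j)) \<circ> (\<lambda>\<omega>. restrict (\<lambda>l. y l \<omega>) {Suc j}))"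
    by (intro indep_var_compose[OF indep_var_restrict[OF step.prems(1)]]) (use step in auto)
  then have indep: "indep_var borel ?A borel (y (Suc j))"
    by (simp add: comp_def)
  have dY: "distributed M lborel (y (Suc j)) (\<lambda>x. ennreal (exponential_density (real (Suc j)) x))"
    using step by (intro step.prems) auto
  have rvA[measurable]: "?A \<in> borel_measurable M" and rvY[measurable]: "y (Suc j) \<in> borel_measurable M"
    using indep_var_rv1[OF indep] indep_var_rv2[OF indep] by auto
  let ?h = "\<lambda>p. ennreal (yule (Suc j) n (s - fst p - snd p))"
  have "(\<integral>\<^sup>+ \<omega>. ennreal (yule (Suc j) n (s - (\<Sum>l\<in>{i<..Suc j}. y l \<omega>))) \<partial>M)
      = (\<integral>\<^sup>+ \<omega>. ?h (?A \<omega>, y (Suc j) \<omega>) \<partial>M)"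
    unfolding ins by (simp add: algebra_simps)
  also have "\<dots> = (\<integral>\<^sup>+ \<omega>. \<integral>\<^sup>+ \<omega>'. ?h (?A \<omega>, y (Suc j) \<omega>') \<partial>M \<partial>M)"
    by (rule indep_var_nn_integral[OF assms(1) indep]) measurable
  also have "\<dots> = (\<integral>\<^sup>+ \<omega>. ennreal (real (Suc j) / real (Suc n)) * ennreal (yule j (Suc n) (s - ?A \<omega>)) \<partial>M)"
    using nn_integral_exponential_yule[OF dY]
    by (intro nn_integral_cong) (simp add: yule_nonneg del: of_nat_Suc flip: ennreal_mult)
  also have "\<dots> = ennreal (real (Suc j) / real (Suc n)) * (\<integral>\<^sup>+ \<omega>. ennreal (yule j (Suc n) (s - ?A \<omega>)) \<partial>M)"
    by (rule nn_integral_cmult) measurable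
  also have "(\<integral>\<^sup>+ \<omega>. ennreal (yule j (Suc n) (s - ?A \<omega>)) \<partial>M)
      = ennreal (real ((Suc n + j) choose i) / real ((Suc n + j) choose j) * yule i (Suc n + j - i) s)"
    using step.prems unfolding ins by (intro step.IH) (auto intro: indep_vars_subset)
  also have "ennreal (real (Suc j) / real (Suc n)) * \<dots>
     = ennreal (real ((n + Suc j) choose i) * (real (Suc j) / real (Suc n) * (1 / real ((Suc n + j) choose j))) * yule i (n + Suc j - i) s)"
    by (subst ennreal_mult[symmetric]) (auto simp: yule_nonneg simp del: of_nat_Suc)
  finally show ?case unfolding binomial_ratio_Suc by simp
qed

text \<open>Serves the termination proof of \<open>occ\<close>, which calls itself on
  \<open>ts ! k\<close> under a bounded quantifier.\<close>

lemma size_nth_less [termination_simp]: "k < length ts \<Longrightarrow> size (ts ! k) < Suc (size_list size ts)"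
  by (meson le_imp_less_Suc nth_mem order_refl size_list_estimation')

text \<open>
  \<open>occ m i t w s\<close>: the tree at time \<open>s\<close> is \<open>t\<close> if at time 0 there is only the root, with \<open>i\<close> keys, and
  \<open>w (u, l)\<close> is the time that node \<open>u\<close> waits for its key number \<open>l\<close>. Here a child counts as an empty
  node from the moment at which its parent is full, and its birth is the arrival of its first key.
\<close>

fun occ :: "nat \<Rightarrow> nat \<Rightarrow> ktree \<Rightarrow> (nat list \<times> nat \<Rightarrow> real) \<Rightarrow> real \<Rightarrow> bool" where
  "occ m i (Lf j) w s \<longleftrightarrow> (\<Sum>l\<in>{i<..j}. w ([], l)) \<le> s \<and> s < (\<Sum>l\<in>{i<..Suc j}. w ([], l))"
| "occ m i (Nd ts) w s \<longleftrightarrow> (\<Sum>l\<in>{i<..m - 1}. w ([], l)) \<le> s \<and>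
     (\<forall>k\<in>{..<length ts}. occ m 0 (ts ! k) (\<lambda>(u, l). w (Suc k # u, l)) (s - (\<Sum>l\<in>{i<..m - 1}. w ([], l))))"

text \<open>The waiting times that a process started with \<open>i\<close> keys in the root can
  consult: at the root only those of later keys, at all other nodes those of every key.\<close>

definition slots :: "nat \<Rightarrow> nat \<Rightarrow> (nat list \<times> nat) set" where
  "slots m i = {(u, l). u \<in> words m \<and> l \<in> {1..m - 1} \<and> (u = [] \<longrightarrow> i < l)}"

lemma slots_Nil: "([], l) \<in> slots m i \<longleftrightarrow> i < l \<and> l \<le> m - 1"
  by (auto simp: slots_def words_def)

lemma slots_Cons: "(i' # u, l) \<in> slots m i \<longleftrightarrow> i' \<in> {1..m} \<and> (u, l) \<in> slots m 0"
  by (auto simp: slots_def words_def)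

text \<open>This is what allows \<open>w\<close> to be restricted to a set of slots, and hence to be
  treated as a point of a product space. Validity keeps the number \<open>Suc j\<close> of the key
  still awaited within \<open>{1..m - 1}\<close>.\<close>

lemma occ_cong:
  assumes "valid m t" "\<And>c. c \<in> slots m i \<Longrightarrow> w c = w' c"
  shows "occ m i t w s = occ m i t w' s"
  using assms
proof (induction t arbitrary: i w w' s)
  case (Lf j)
  have "(\<Sum>l\<in>{i<..j}. w ([], l)) = (\<Sum>l\<in>{i<..j}. w' ([], l))"
    "(\<Sum>l\<in>{i<..Suc j}. w ([], l)) = (\<Sum>l\<in>{i<..Suc j}. w' ([], l))"
    using Lf by (auto intro!: sum.cong simp: slots_Nil)
  then show ?case by simp
next
  case (Nd ts)
  have A: "(\<Sum>l\<in>{i<..m - 1}. w ([], l)) = (\<Sum>l\<in>{i<..m - 1}. w' ([], l))"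
    using Nd by (auto intro!: sum.cong simp: slots_Nil)
  have "occ m 0 (ts ! k) (\<lambda>(u, l). w (Suc k # u, l)) r = occ m 0 (ts ! k) (\<lambda>(u, l). w' (Suc k # u, l)) r"
    if "k < length ts" for k r
    using that Nd.prems by (intro Nd.IH) (auto simp: slots_Cons)
  then show ?case unfolding occ.simps A by auto
qed

lemma measurable_occ:
  assumes "valid m t" "\<And>c. c \<in> slots m i \<Longrightarrow> (\<lambda>x. f x c) \<in> borel_measurable N"
    "g \<in> borel_measurable N"
  shows "Measurable.pred N (\<lambda>x. occ m i t (f x) (g x))"
  using assms
proof (induction t arbitrary: i f g)
  case (Lf j)
  note Lf(3)[measurable]
  have [measurable]: "(\<lambda>x. \<Sum>l\<in>{i<..j}. f x ([], l)) \<in> borel_measurable N"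
    "(\<lambda>x. \<Sum>l\<in>{i<..Suc j}. f x ([], l)) \<in> borel_measurable N"
    using Lf by (auto intro!: borel_measurable_sum simp: slots_Nil)
  show ?case unfolding occ.simps by measurable
next
  case (Nd ts)
  note Nd.prems(3)[measurable]
  have [measurable]: "(\<lambda>x. \<Sum>l\<in>{i<..m - 1}. f x ([], l)) \<in> borel_measurable N"
    using Nd by (intro borel_measurable_sum) (auto simp: slots_Nil)
  have "Measurable.pred N (\<lambda>x. \<forall>k\<in>{..<length ts}.
      occ m 0 (ts ! k) (\<lambda>(u, l). f x (Suc k # u, l)) (g x - (\<Sum>l\<in>{i<..m - 1}. f x ([], l))))"
  proof (rule pred_intros_finite)
    fix k assume k: "k \<in> {..<length ts}"
    show "Measurable.pred N (\<lambda>x. occ m 0 (ts ! k) (\<lambda>(u, l). f x (Suc k # u, l)) (g x - (\<Sum>l\<in>{i<..m - 1}. f x ([], l))))"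
    proof (rule Nd.IH)
      show "(\<lambda>x. (case c of (u, l) \<Rightarrow> f x (Suc k # u, l))) \<in> borel_measurable N" if "c \<in> slots m 0" for c
        using that k Nd.prems by (cases c) (auto simp: slots_Cons)
      show "(\<lambda>x. g x - (\<Sum>l\<in>{i<..m - 1}. f x ([], l))) \<in> borel_measurable N" by measurable
    qed (use k Nd.prems in auto)
  qed simp
  then show ?case unfolding occ.simps by measurable
qed

text \<open>Superposition: independent families that each start from one gap behave together like a
  single family started from all these gaps.\<close>

lemma yule_prod:
  assumes "r \<ge> 0" "finite I" "card I = Suc j"
  shows "(\<Prod>k\<in>I. yule 0 (n k) r) = yule j (\<Sum>k\<in>I. n k) r"
proof -
  have "(\<Prod>k\<in>I. yule 0 (n k) r) = exp (- r) ^ Suc j * (1 - exp (- r)) ^ (\<Sum>k\<in>I. n k)"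
    using assms by (simp add: yule_def prod.distrib power_sum)
  also have "exp (- r) ^ Suc j = exp (- (real j + 1) * r)"
    by (simp add: exp_of_nat_mult[symmetric] algebra_simps del: power_Suc)
  finally show ?thesis using assms by (simp add: yule_def)
qed

text \<open>Carries independence along an injection of index sets: from all slots to those of the
  root or, after a shift of words, of a subtree, and from clocks to slots.\<close>

lemma indep_vars_reindex':
  assumes "prob_space M" "prob_space.indep_vars M N X I" "inj_on f J" "f ` J \<subseteq> I"
  shows "prob_space.indep_vars M (\<lambda>j. N (f j)) (\<lambda>j. X (f j)) J"
proof -
  interpret prob_space M by fact
  have ind: "indep_vars N X (f ` J)" by (rule indep_vars_subset[OF assms(2,4)])
  have rv: "random_variable (N (f j)) (X (f j))" if "j \<in> J" for j
    using ind that by (auto simp: indep_vars_def)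
  let ?F = "\<lambda>i. {X i -` A \<inter> space M |A. A \<in> sets (N i)}"
  have "indep_sets (\<lambda>j. ?F (f j)) J"
  proof (rule indep_setsI)
    fix j assume "j \<in> J"
    then show "?F (f j) \<subseteq> events" using rv by (auto intro: measurable_sets)
  next
    fix A K assume K: "K \<noteq> {}" "K \<subseteq> J" "finite K" "\<forall>j\<in>K. A j \<in> ?F (f j)"
    have inj: "inj_on f K" using assms(3) K(2) by (rule inj_on_subset)
    define B where "B i = A (the_inv_into K f i)" for i
    have B: "B (f j) = A j" if "j \<in> K" for j
      using that inj by (simp add: B_def the_inv_into_f_f)
    have "indep_sets ?F (f ` J)" using ind by (simp add: indep_vars_def2)
    then have "prob (\<Inter>i\<in>f ` K. B i) = (\<Prod>i\<in>f ` K. prob (B i))"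
      by (rule indep_setsD) (use K B in auto)
    then show "prob (\<Inter>(A ` K)) = (\<Prod>j\<in>K. prob (A j))"
      using B inj by (simp add: prod.reindex)
  qed
  then show ?thesis using rv by (simp add: indep_vars_def2)
qed

text \<open>The family \<open>W\<close> varies in the induction, because the shifted family
  \<open>W (Suc k # u, l)\<close> of a subtree satisfies the same hypotheses. Integrating out the
  root waits produces a ratio of binomial coefficients: its numerator is the factor
  \<open>choose i\<close> of the claim, its denominator turns the product of the subtree weights
  into the weight of the whole tree.\<close>

theorem emeasure_occ:
  assumes m: "m \<ge> 2" and M: "prob_space M"
    and "valid m t" "prob_space.indep_vars M (\<lambda>_. borel) W (slots m i)"
    and "\<And>u l. (u, l) \<in> slots m i \<Longrightarrow>
      distributed M lborel (W (u, l)) (\<lambda>x. ennreal (exponential_density (real l) x))"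
    and "i \<le> rkeys m t"
  shows "emeasure M {\<omega> \<in> space M. occ m i t (\<lambda>c. W c \<omega>) s}
    = ennreal (real (nkeys m t choose i) * weight m t * yule i (nkeys m t - i) s)"
  using assms(3-)
proof (induction t arbitrary: i W s)
  case (Lf j)
  interpret prob_space M by fact
  have j: "Suc j \<le> m - 1" "i \<le> j" using Lf by auto
  have indy: "indep_vars (\<lambda>_. borel) (\<lambda>l. W ([], l)) {i<..Suc j}"
    by (rule indep_vars_reindex'[OF M Lf.prems(2), of "\<lambda>l. ([], l)"])
      (use j in \<open>auto simp: inj_on_def slots_Nil\<close>)
  have dist: "distributed M lborel (W ([], l)) (\<lambda>x. ennreal (exponential_density (real l) x))" if "l \<in> {i<..Suc j}" for l
    using that j by (intro Lf.prems) (auto simp: slots_Nil)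
  let ?A = "\<lambda>\<omega>. \<Sum>l\<in>{i<..j}. W ([], l) \<omega>"
  let ?Y = "W ([], Suc j)"
  have ins: "{i<..Suc j} = insert (Suc j) {i<..j}" using j by auto
  have "indep_var borel ((\<lambda>f. \<Sum>l\<in>{i<..j}. f l) \<circ> (\<lambda>\<omega>. restrict (\<lambda>l. W ([], l) \<omega>) {i<..j}))
      borel ((\<lambda>f. f (Suc j)) \<circ> (\<lambda>\<omega>. restrict (\<lambda>l. W ([], l) \<omega>) {Suc j}))"
    by (intro indep_var_compose[OF indep_var_restrict[OF indy]]) (use j in auto)
  then have indep: "indep_var borel ?A borel ?Y"
    by (simp add: comp_def)
  \<comment> \<open>With key \<open>j\<close> in place at time \<open>a\<close>, the next wait, of
    rate \<open>j + 1\<close>, must last beyond time \<open>s\<close>. The corresponding survival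
    probability is \<open>yule j 0 (s - a)\<close>, and for \<open>a > s\<close> both sides are
    0.\<close>
  have inner: "emeasure M {\<omega>' \<in> space M. a \<le> s \<and> s < a + ?Y \<omega>'} = ennreal (yule j 0 (s - a))" for a
  proof (cases "a \<le> s")
    case True
    have "prob {\<omega>' \<in> space M. s - a < ?Y \<omega>'} = exp (- (s - a) * real (Suc j))"
      using True dist[of "Suc j"] j by (intro exponential_distributedD_gt) auto
    moreover have "{\<omega>' \<in> space M. s - a < ?Y \<omega>'} = {\<omega>' \<in> space M. a \<le> s \<and> s < a + ?Y \<omega>'}"
      using True by auto
    ultimately show ?thesis using True by (simp add: emeasure_eq_measure yule_def algebra_simps)
  next
    case False
    then show ?thesis by (simp add: yule_def)
  qed
  have "emeasure M {\<omega> \<in> space M. occ m i (Lf j) (\<lambda>c. W c \<omega>) s}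
      = emeasure M {\<omega> \<in> space M. ?A \<omega> \<le> s \<and> s < ?A \<omega> + ?Y \<omega>}"
    unfolding occ.simps ins by (simp add: add.commute)
  also have "\<dots> = (\<integral>\<^sup>+ \<omega>. emeasure M {\<omega>' \<in> space M. ?A \<omega> \<le> s \<and> s < ?A \<omega> + ?Y \<omega>'} \<partial>M)"
    by (rule indep_var_emeasure[OF M indep]) measurable
  also have "\<dots> = (\<integral>\<^sup>+ \<omega>. ennreal (yule j 0 (s - ?A \<omega>)) \<partial>M)"
    unfolding inner ..
  also have "\<dots> = ennreal (real ((0 + j) choose i) / real ((0 + j) choose j) * yule i (0 + j - i) s)"
    by (rule nn_integral_sum_exponential_yule[OF M])
      (use j dist in \<open>auto intro: indep_vars_subset[OF indy]\<close>)
  finally show ?case by simp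
next
  case (Nd ts)
  interpret prob_space M by fact
  have len: "length ts = m" and i: "i \<le> m - 1" using Nd.prems by auto
  let ?I = "slots m i"
  let ?R = "{i<..m - 1}"
  \<comment> \<open>\<open>B\<close> holds the slots below the root. They are disjoint from the root
    slots, so the time at which the root fills up is independent of all waits in the
    subtrees.\<close>
  define B where "B = {c \<in> ?I. fst c \<noteq> []}"
  let ?A = "\<lambda>\<omega>. \<Sum>l\<in>?R. W ([], l) \<omega>"
  let ?WB = "\<lambda>\<omega>. restrict (\<lambda>c. W c \<omega>) B"
  let ?sh = "\<lambda>(w :: nat list \<times> nat \<Rightarrow> real) k (u, l). w (Suc k # u, l)"
  let ?P = "\<lambda>a w. a \<le> s \<and> (\<forall>k\<in>{..<m}. occ m 0 (ts ! k) (?sh w k) (s - a))"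
  have inB: "(Suc k # u, l) \<in> B \<longleftrightarrow> (u, l) \<in> slots m 0" if "k < m" for k u l
    using that by (auto simp: B_def slots_Cons)
  have indy: "indep_vars (\<lambda>_. borel) (\<lambda>l. W ([], l)) ?R"
    by (rule indep_vars_reindex'[OF M Nd.prems(2), of "\<lambda>l. ([], l)"])
      (auto simp: inj_on_def slots_Nil)
  have dist: "distributed M lborel (W ([], l)) (\<lambda>x. ennreal (exponential_density (real l) x))" if "l \<in> ?R" for l
    using that by (intro Nd.prems) (auto simp: slots_Nil)
  let ?NR = "Pair [] ` ?R"
  let ?WR = "\<lambda>\<omega>. restrict (\<lambda>c. W c \<omega>) ?NR"
  let ?S = "\<lambda>w :: nat list \<times> nat \<Rightarrow> real. \<Sum>l\<in>?R. w ([], l)"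
  have indep: "indep_var (PiM ?NR (\<lambda>_. borel)) ?WR (PiM B (\<lambda>_. borel)) ?WB"
    by (rule indep_var_restrict[OF Nd.prems(2)]) (auto simp: B_def slots_Nil)
  have A: "?A \<omega> = ?S (?WR \<omega>)" for \<omega>
    by (intro sum.cong) auto
  have cong: "occ m 0 (ts ! k) (?sh (?WB \<omega>) k) r = occ m 0 (ts ! k) (?sh (\<lambda>c. W c \<omega>) k) r"
    if "k < m" for k \<omega> r
    using that Nd.prems len by (intro occ_cong) (auto simp: inB)
  have meas: "Measurable.pred (PiM ?NR (\<lambda>_. borel) \<Otimes>\<^sub>M PiM B (\<lambda>_. borel)) (\<lambda>p. ?P (?S (fst p)) (snd p))"
    (is "Measurable.pred ?Q _")
  proof -
    have S[measurable]: "(\<lambda>p. ?S (fst p)) \<in> borel_measurable ?Q"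
      by (intro borel_measurable_sum) simp
    have "Measurable.pred ?Q (\<lambda>p. \<forall>k\<in>{..<m}. occ m 0 (ts ! k) (?sh (snd p) k) (s - ?S (fst p)))"
    proof (intro pred_intros_finite measurable_occ)
      fix k c assume k: "k \<in> {..<m}" and c: "c \<in> slots m 0"
      obtain u l where "c = (u, l)" by (cases c)
      then have [measurable]: "(Suc k # u, l) \<in> B" using inB[of k u l] k c by auto
      show "(\<lambda>p. ?sh (snd p) k c) \<in> borel_measurable ?Q"
        unfolding \<open>c = (u, l)\<close> by simp
    qed (use Nd.prems len in auto)
    then show ?thesis by measurable
  qed
  define n where "n = (\<Sum>k<m. nkeys m (ts ! k))"
  define p where "p = (\<Prod>k<m. weight m (ts ! k))"
  have n: "nkeys m (Nd ts) = n + (m - 1)"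
    using len by (simp add: n_def sum_list_sum_nth atLeast0LessThan)
  have p: "weight m (Nd ts) = p / real ((n + (m - 1)) choose (m - 1))"
    unfolding weight.simps n using len by (simp add: p_def prod.list_conv_set_nth atLeast0LessThan)
  have p0: "p \<ge> 0" unfolding p_def by (intro prod_nonneg) (simp add: weight_pos less_imp_le)
  have inner: "emeasure M {\<omega> \<in> space M. ?P a (?WB \<omega>)} = ennreal (p * yule (m - 1) n (s - a))" for a
  proof (cases "a \<le> s")
    case True
    define r where "r = s - a"
    have r: "r \<ge> 0" using True by (simp add: r_def)
    have INT_Collect: "(\<Inter>k\<in>{..<m}. {\<omega> \<in> space M. Q k \<omega>}) = {\<omega> \<in> space M. \<forall>k\<in>{..<m}. Q k \<omega>}" for Q
    proof (intro equalityI subsetI)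
      fix x assume x: "x \<in> (\<Inter>k\<in>{..<m}. {\<omega> \<in> space M. Q k \<omega>})"
      have "x \<in> {\<omega> \<in> space M. Q 0 \<omega>}" using x by (rule INT_D) (use m in simp)
      then show "x \<in> {\<omega> \<in> space M. \<forall>k\<in>{..<m}. Q k \<omega>}" using x by auto
    qed auto
    \<comment> \<open>The slots of the \<open>k\<close>-th subtree: their words begin with
      \<open>Suc k\<close>, so the blocks are disjoint and the subtrees independent.\<close>
    let ?K = "\<lambda>k. (\<lambda>(u, l). (Suc k # u, l)) ` slots m 0"
    have K: "?K k \<subseteq> ?I" if "k \<in> {..<m}" for k
      using that by (auto simp: slots_Cons)
    have dis: "disjoint_family_on ?K {..<m}" by (auto simp: disjoint_family_on_def)
    have ind: "indep_vars (\<lambda>k. PiM (?K k) (\<lambda>_. borel)) (\<lambda>k \<omega>. restrict (\<lambda>c. W c \<omega>) (?K k)) {..<m}"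
      by (rule indep_vars_restrict[OF Nd.prems(2) K dis])
    let ?E = "\<lambda>k. {w \<in> space (PiM (?K k) (\<lambda>_. borel)). occ m 0 (ts ! k) (?sh w k) r}"
    have E: "?E k \<in> sets (PiM (?K k) (\<lambda>_. borel))" if k: "k \<in> {..<m}" for k
    proof -
      have "Measurable.pred (PiM (?K k) (\<lambda>_. borel)) (\<lambda>w. occ m 0 (ts ! k) (?sh w k) r)"
      proof (rule measurable_occ)
        fix c assume c: "c \<in> slots m 0"
        obtain u l where ul: "c = (u, l)" by (cases c)
        then have "(Suc k # u, l) \<in> ?K k" using c by force
        then show "(\<lambda>w. ?sh w k c) \<in> borel_measurable (PiM (?K k) (\<lambda>_. borel))"
          unfolding ul by (simp add: measurable_component_singleton)
      qed (use k Nd.prems len in auto)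
      then show ?thesis by (simp add: pred_def)
    qed
    have pre: "(\<lambda>\<omega>. restrict (\<lambda>c. W c \<omega>) (?K k)) -` ?E k \<inter> space M
       = {\<omega> \<in> space M. occ m 0 (ts ! k) (\<lambda>c. ?sh (\<lambda>c. W c \<omega>) k c) r}" if k: "k \<in> {..<m}" for k
    proof -
      have "occ m 0 (ts ! k) (?sh (restrict (\<lambda>c. W c \<omega>) (?K k)) k) r = occ m 0 (ts ! k) (?sh (\<lambda>c. W c \<omega>) k) r" for \<omega>
        using k Nd.prems len by (intro occ_cong) force+
      then show ?thesis by (auto simp: space_PiM)
    qed
    have IH: "prob {\<omega> \<in> space M. occ m 0 (ts ! k) (\<lambda>c. ?sh (\<lambda>c. W c \<omega>) k c) r}
        = weight m (ts ! k) * yule 0 (nkeys m (ts ! k)) r" if k: "k \<in> {..<m}" for k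
    proof -
      have "emeasure M {\<omega> \<in> space M. occ m 0 (ts ! k) (\<lambda>c. (case c of (u, l) \<Rightarrow> W (Suc k # u, l)) \<omega>) r}
        = ennreal (real (nkeys m (ts ! k) choose 0) * weight m (ts ! k) * yule 0 (nkeys m (ts ! k) - 0) r)"
      proof (rule Nd.IH)
        have "indep_vars (\<lambda>_. borel) (\<lambda>c. W (case c of (u, l) \<Rightarrow> (Suc k # u, l))) (slots m 0)"
          by (rule indep_vars_reindex'[OF M Nd.prems(2)]) (use K k in \<open>auto simp: inj_on_def\<close>)
        then show "indep_vars (\<lambda>_. borel) (\<lambda>c. case c of (u, l) \<Rightarrow> W (Suc k # u, l)) (slots m 0)"
          by (simp add: case_prod_unfold)
        show "distributed M lborel (case (u, l) of (u, l) \<Rightarrow> W (Suc k # u, l)) (\<lambda>x. ennreal (exponential_density (real l) x))"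
          if "(u, l) \<in> slots m 0" for u l
          using that k Nd.prems(3)[of "Suc k # u" l] by (simp add: slots_Cons)
      qed (use k Nd.prems len in auto)
      then show ?thesis
        by (simp add: case_prod_unfold emeasure_eq_measure weight_pos less_imp_le yule_nonneg)
    qed
    have "prob {\<omega> \<in> space M. ?P a (?WB \<omega>)}
      = prob (\<Inter>k\<in>{..<m}. (\<lambda>\<omega>. restrict (\<lambda>c. W c \<omega>) (?K k)) -` ?E k \<inter> space M)"
    proof (rule arg_cong[where f=prob])
      have "(\<Inter>k\<in>{..<m}. (\<lambda>\<omega>. restrict (\<lambda>c. W c \<omega>) (?K k)) -` ?E k \<inter> space M)
         = (\<Inter>k\<in>{..<m}. {\<omega> \<in> space M. occ m 0 (ts ! k) (?sh (\<lambda>c. W c \<omega>) k) r})"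
        using pre by (intro INF_cong refl) simp
      also have "\<dots> = {\<omega> \<in> space M. ?P a (?WB \<omega>)}"
        using cong True m by (subst INT_Collect) (auto simp: r_def)
      finally show "{\<omega> \<in> space M. ?P a (?WB \<omega>)} = (\<Inter>k\<in>{..<m}. (\<lambda>\<omega>. restrict (\<lambda>c. W c \<omega>) (?K k)) -` ?E k \<inter> space M)"
        by simp
    qed
    also have "\<dots> = (\<Prod>k\<in>{..<m}. prob ((\<lambda>\<omega>. restrict (\<lambda>c. W c \<omega>) (?K k)) -` ?E k \<inter> space M))"
      by (rule indep_varsD[OF ind]) (use m E in \<open>auto simp: lessThan_empty_iff\<close>)
    also have "\<dots> = (\<Prod>k\<in>{..<m}. weight m (ts ! k) * yule 0 (nkeys m (ts ! k)) r)"
      by (intro prod.cong refl) (simp only: pre IH)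
    \<comment> \<open>The \<open>m\<close> empty children of a full root contribute one gap each,
      and \<open>m\<close> gaps are encoded by the index \<open>m - 1\<close>.\<close>
    also have "\<dots> = p * yule (m - 1) n r"
      using r m by (simp add: prod.distrib p_def n_def yule_prod)
    finally show ?thesis by (simp add: emeasure_eq_measure r_def)
  next
    case False
    then show ?thesis by (simp add: yule_def)
  qed
  have [measurable]: "?A \<in> borel_measurable M"
    using distributed_measurable[OF dist] by (intro borel_measurable_sum) simp
  have "emeasure M {\<omega> \<in> space M. occ m i (Nd ts) (\<lambda>c. W c \<omega>) s} = emeasure M {\<omega> \<in> space M. ?P (?A \<omega>) (?WB \<omega>)}"
    unfolding occ.simps using cong len by (intro arg_cong[where f="emeasure M"]) auto
  also have "\<dots> = (\<integral>\<^sup>+ \<omega>. emeasure M {\<omega>' \<in> space M. ?P (?A \<omega>) (?WB \<omega>')} \<partial>M)"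
    unfolding A by (rule indep_var_emeasure[OF M indep meas])
  also have "\<dots> = (\<integral>\<^sup>+ \<omega>. ennreal p * ennreal (yule (m - 1) n (s - ?A \<omega>)) \<partial>M)"
    unfolding inner using p0 by (intro nn_integral_cong) (simp add: ennreal_mult yule_nonneg)
  also have "\<dots> = ennreal p * (\<integral>\<^sup>+ \<omega>. ennreal (yule (m - 1) n (s - ?A \<omega>)) \<partial>M)"
    by (rule nn_integral_cmult) measurable
  also have "(\<integral>\<^sup>+ \<omega>. ennreal (yule (m - 1) n (s - ?A \<omega>)) \<partial>M)
     = ennreal (real ((n + (m - 1)) choose i) / real ((n + (m - 1)) choose (m - 1)) * yule i (n + (m - 1) - i) s)"
    by (rule nn_integral_sum_exponential_yule[OF M indy dist i])
  also have "ennreal p * \<dots> = ennreal (real (nkeys m (Nd ts) choose i) * weight m (Nd ts) * yule i (nkeys m (Nd ts) - i) s)"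
    unfolding n p using p0 by (subst ennreal_mult[symmetric]) (auto simp: yule_nonneg)
  finally show ?case .
qed

section \<open>From clocks to fringe trees\<close>

text \<open>
  Slot \<open>(u, l)\<close> is the waiting time for key number \<open>l\<close> of node \<open>u\<close>, so it has rate \<open>l\<close>; the first key
  of a node other than the root arrives with its birth. The root is born with one key, which leaves
  the slot \<open>([], 1)\<close> free for the sampling time, also of rate 1.
\<close>

fun slot_clock :: "nat list \<times> nat \<Rightarrow> clock" where
  "slot_clock (u, l) =
     (if l = 1 then if u = [] then Sampling else Child_Wait (butlast u) (last u) else Key_Wait u l)"

lemma slot_clock_in_clocks: "c \<in> slots m 0 \<Longrightarrow> m \<ge> 2 \<Longrightarrow> slot_clock c \<in> clocks m"
proof -
  assume c: "c \<in> slots m 0" and m: "m \<ge> 2"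
  obtain u l where ul: "c = (u, l)" by (cases c)
  show ?thesis
  proof (cases "u = []")
    case True
    then show ?thesis using c m unfolding ul by (auto simp: clocks_def slots_def)
  next
    case False
    then have "butlast u \<in> words m" "last u \<in> {1..m}"
      using c unfolding ul slots_def words_def by (auto dest: in_set_butlastD)
    then show ?thesis using c m False unfolding ul by (auto simp: clocks_def slots_def)
  qed
qed

lemma inj_on_slot_clock: "inj_on slot_clock A"
proof (rule inj_onI)
  fix c c' assume "slot_clock c = slot_clock c'"
  then show "c = c'"
    by (cases c; cases c') (auto split: if_splits, metis append_butlast_last_id)
qed

lemma clock_rate_slot: "clock_rate (slot_clock (u, l)) = real l"
  by auto

text \<open>Here a node opens, empty, when its parent is full, and \<open>j = 0\<close> gives that
  moment. The wait for the first key belongs to the node itself, whereas \<open>birth_time\<close>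
  charges it to the parent as a \<open>Child_Wait\<close>.\<close>

definition arrival :: "nat \<Rightarrow> (nat list \<times> nat \<Rightarrow> real) \<Rightarrow> nat list \<Rightarrow> nat \<Rightarrow> real" where
  "arrival m w u j = (\<Sum>k<length u. \<Sum>l\<in>{0<..m - 1}. w (take k u, l)) + (\<Sum>l\<in>{0<..j}. w (u, l))"

lemma arrival_Cons:
  "arrival m w (i # u) j = (\<Sum>l\<in>{0<..m - 1}. w ([], l)) + arrival m (\<lambda>(u, l). w (i # u, l)) u j"
  by (simp add: arrival_def sum.lessThan_Suc_shift del: sum.lessThan_Suc)

lemma arrival_mono:
  assumes "\<forall>c\<in>slots m 0. w c \<ge> 0" "u \<in> words m" "j \<le> j'" "j' \<le> m - 1"
  shows "arrival m w u j \<le> arrival m w u j'"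
  unfolding arrival_def using assms
  by (intro add_left_mono sum_mono2) (auto simp: slots_def)

text \<open>\<open>occ\<close> constrains only partial sums at the nodes of \<open>t\<close>.
  Nonnegative waits make arrival times monotone at each node and along each branch, which settles
  the other key numbers and the words outside the tree.\<close>

lemma occ_keys_at:
  assumes "m \<ge> 2" "valid m t" "\<forall>c\<in>slots m 0. w c \<ge> 0" "occ m 0 t w s" "u \<in> words m"
  shows "keys_at m t u = card {j \<in> {1..m - 1}. arrival m w u j \<le> s}"
  using assms(2-)
proof (induction t arbitrary: w s u)
  case (Lf j)
  have occ: "arrival m w [] j \<le> s" "s < arrival m w [] (Suc j)" and j: "Suc j \<le> m - 1"
    using Lf by (auto simp: arrival_def)
  have Nil: "[] \<in> words m" by (simp add: words_def)
  show ?case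
  proof (cases u)
    case u: Nil
    have "{j' \<in> {1..m - 1}. arrival m w [] j' \<le> s} = {1..j}"
    proof (intro equalityI subsetI)
      fix j' assume j': "j' \<in> {j' \<in> {1..m - 1}. arrival m w [] j' \<le> s}"
      have "\<not> Suc j \<le> j'"
        using arrival_mono[OF Lf(2) Nil, where j = "Suc j" and j' = j'] occ j' by auto
      then show "j' \<in> {1..j}" using j' by auto
    next
      fix j' assume "j' \<in> {1..j}"
      then show "j' \<in> {j' \<in> {1..m - 1}. arrival m w [] j' \<le> s}"
        using arrival_mono[OF Lf(2) Nil, where j = j' and j' = j] occ j by auto
    qed
    then show ?thesis using u by simp
  next
    case (Cons i v)
    have "s < arrival m w u j'" if "j' \<in> {1..m - 1}" for j'
    proof -
      \<comment> \<open>The root is not full at time \<open>s\<close>, so every proper descendant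
        opens later than \<open>s\<close>.\<close>
      have "s < arrival m w [] (m - 1)"
        using occ(2) arrival_mono[OF Lf(2) Nil, where j = "Suc j" and j' = "m - 1"] j by auto
      also have "\<dots> = (\<Sum>l\<in>{0<..m - 1}. w ([], l))" by (simp add: arrival_def)
      also have "\<dots> \<le> arrival m w u 0"
      proof -
        have "0 \<le> w (i # take k v, l)" if "l \<in> {0<..m - 1}" for k l
        proof -
          have "(i # take k v, l) \<in> slots m 0"
            using that Lf(4) unfolding Cons by (auto simp: slots_def words_def dest: in_set_takeD)
          then show ?thesis using Lf(2) by blast
        qed
        then have "0 \<le> arrival m (\<lambda>(u, l). w (i # u, l)) v 0"
          unfolding arrival_def by (auto intro!: add_nonneg_nonneg sum_nonneg)
        then show ?thesis unfolding Cons arrival_Cons by simp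
      qed
      also have "\<dots> \<le> arrival m w u j'"
        using arrival_mono[OF Lf(2,4), where j = 0 and j' = j'] that by auto
      finally show ?thesis .
    qed
    then have "{j' \<in> {1..m - 1}. arrival m w u j' \<le> s} = {}" by force
    then show ?thesis using Cons by simp
  qed
next
  case (Nd ts)
  show ?case
  proof (cases u)
    case u: Nil
    have "arrival m w [] j' \<le> s" if "j' \<in> {1..m - 1}" for j'
    proof -
      have "arrival m w [] (m - 1) \<le> s" using Nd.prems by (simp add: arrival_def)
      then show ?thesis
        using arrival_mono[OF Nd.prems(2), where u = "[]" and j = j' and j' = "m - 1"] that by (auto simp: words_def)
    qed
    then have "{j' \<in> {1..m - 1}. arrival m w u j' \<le> s} = {1..m - 1}" using u by auto
    then show ?thesis using u by simp
  next
    case (Cons i v)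
    have iv: "i \<in> {1..m}" "v \<in> words m" using Nd.prems Cons by (auto simp: words_def)
    then obtain k where k: "i = Suc k" "k < length ts" using Nd.prems by (cases i) auto
    have "keys_at m (ts ! k) v
      = card {j \<in> {1..m - 1}. arrival m (\<lambda>(u, l). w (i # u, l)) v j \<le> s - (\<Sum>l\<in>{0<..m - 1}. w ([], l))}"
    proof (rule Nd.IH)
      show "\<forall>c\<in>slots m 0. 0 \<le> (case c of (u, l) \<Rightarrow> w (i # u, l))"
        using iv Nd.prems(2) by (auto simp: slots_Cons)
    qed (use Nd.prems k iv in auto)
    then show ?thesis using k Nd.prems iv unfolding Cons arrival_Cons by (simp add: algebra_simps)
  qed
qed

text \<open>Starting with one key is the same as starting empty with a first wait of length 0. This
  brings the root into line with its subtrees, all of which start empty.\<close>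

lemma occ_drop_first:
  assumes "m \<ge> 2" "rkeys m t \<ge> 1" "occ m 1 t w s"
  shows "occ m 0 t (w(([], 1) := 0)) s"
proof -
  have eq: "(\<Sum>l\<in>{0<..j}. (w(([], 1) := 0)) ([], l)) = (\<Sum>l\<in>{1<..j}. w ([], l))" if "j \<ge> 1" for j
  proof -
    have "{0<..j} = insert 1 {1<..j}" using that by auto
    then show ?thesis by simp
  qed
  have sh: "(\<lambda>(u, l). (w(([], 1) := 0)) (Suc k # u, l)) = (\<lambda>(u, l). w (Suc k # u, l))" for k
    by auto
  show ?thesis
  proof (cases t)
    case (Lf j)
    then show ?thesis using assms eq[of j] eq[of "Suc j"] by simp
  next
    case (Nd ts)
    then show ?thesis using assms eq[of "m - 1"] unfolding Nd occ.simps sh by auto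
  qed
qed

text \<open>The slot with \<open>l = 1\<close> of \<open>take (Suc k) u\<close> is the child clock
  of \<open>take k u\<close>. Along the path to \<open>u\<close> the first waits are thus the child
  waits shifted by one generation, and the unmatched term at the root is 0 by the choice of
  \<open>w\<close>.\<close>

lemma arrival_birth_time:
  assumes "w = (\<lambda>c. z (slot_clock c))(([], 1) := 0)" "j \<ge> 1" "m \<ge> 2"
  shows "arrival m w u j = birth_time m z u + key_age z u j"
proof -
  have root: "w (v, 1) = (if v = [] then 0 else z (Child_Wait (butlast v) (last v)))" for v
    by (simp add: assms(1))
  have split: "(\<Sum>l\<in>{0<..j'}. w (v, l)) = w (v, 1) + key_age z v j'" if "j' \<ge> 1" for v j'
  proof -
    have "{0<..j'} = insert 1 {2..j'}" using that by auto
    then have "(\<Sum>l\<in>{0<..j'}. w (v, l)) = w (v, 1) + (\<Sum>l\<in>{2..j'}. w (v, l))" by simp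
    also have "(\<Sum>l\<in>{2..j'}. w (v, l)) = key_age z v j'"
      unfolding key_age_def by (intro sum.cong) (auto simp: assms(1))
    finally show ?thesis .
  qed
  have "(\<Sum>k<length u. w (take k u, 1)) + w (u, 1) = (\<Sum>k<Suc (length u). w (take k u, 1))"
    by simp
  also have "\<dots> = w ([], 1) + (\<Sum>k<length u. w (take (Suc k) u, 1))"
    by (subst sum.lessThan_Suc_shift) simp
  also have "\<dots> = (\<Sum>k<length u. z (Child_Wait (take k u) (u ! k)))"
    using root by (auto intro!: sum.cong simp: take_Suc_conv_app_nth)
  finally have tele: "(\<Sum>k<length u. w (take k u, 1)) + w (u, 1) = (\<Sum>k<length u. z (Child_Wait (take k u) (u ! k)))" .
  have "arrival m w u j = (\<Sum>k<length u. w (take k u, 1) + key_age z (take k u) (m - 1)) + (w (u, 1) + key_age z u j)"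
    unfolding arrival_def using assms(2,3) by (simp add: split)
  also have "\<dots> = birth_time m z u + key_age z u j"
    using tele by (simp add: sum.distrib birth_time_def)
  finally show ?thesis .
qed

text \<open>The first key arrives at birth, so a word receives no key by the sampling time exactly
  when it is unborn. Hence the value 0 of \<open>keys_at\<close> matches \<open>None\<close> in the
  family tree.\<close>

lemma fringe_tree_eq_ltree_of:
  assumes m: "m \<ge> 2" and t: "valid m t" "rkeys m t \<ge> 1"
    and nonneg: "\<And>c. c \<in> slots m 0 \<Longrightarrow> z (slot_clock c) \<ge> 0"
    and occ: "occ m 1 t (\<lambda>c. z (slot_clock c)) (z Sampling)"
  shows "fringe_tree m z = ltree_of m t"
proof
  fix u
  define w where "w = (\<lambda>c. z (slot_clock c))(([], 1) := 0)"
  let ?s = "z Sampling"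
  show "fringe_tree m z u = ltree_of m t u"
  proof (cases "u \<in> words m")
    case True
    have w0: "\<forall>c\<in>slots m 0. w c \<ge> 0"
      using nonneg by (simp add: w_def)
    have occ0: "occ m 0 t w ?s"
      unfolding w_def by (rule occ_drop_first[OF m t(2) occ])
    have arr: "arrival m w u j = birth_time m z u + key_age z u j" if "j \<ge> 1" for j
      using arrival_birth_time[OF w_def that m] .
    have keys: "keys_at m t u = card {j \<in> {1..m - 1}. birth_time m z u + key_age z u j \<le> ?s}"
    proof -
      have "keys_at m t u = card {j \<in> {1..m - 1}. arrival m w u j \<le> ?s}"
        by (rule occ_keys_at[OF m t(1) w0 occ0 True])
      also have "{j \<in> {1..m - 1}. arrival m w u j \<le> ?s} = {j \<in> {1..m - 1}. birth_time m z u + key_age z u j \<le> ?s}"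
        by (auto simp: arr)
      finally show ?thesis .
    qed
    have first: "arrival m w u 1 = birth_time m z u"
      using arr[of 1] by (simp add: key_age_def)
    have "keys_at m t u = 0 \<longleftrightarrow> \<not> birth_time m z u \<le> ?s"
    proof
      assume "keys_at m t u = 0"
      then have "{j \<in> {1..m - 1}. birth_time m z u + key_age z u j \<le> ?s} = {}"
        unfolding keys by (subst (asm) card_0_eq) auto
      moreover have "1 \<in> {1..m - 1}" using m by simp
      ultimately have "\<not> birth_time m z u + key_age z u 1 \<le> ?s" by blast
      then show "\<not> birth_time m z u \<le> ?s" by (simp add: key_age_def)
    next
      assume b: "\<not> birth_time m z u \<le> ?s"
      have "\<not> birth_time m z u + key_age z u j \<le> ?s" if "j \<in> {1..m - 1}" for j
        using arrival_mono[OF w0 True, where j = 1 and j' = j] that b first arr[of j] by auto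
      then have "{j \<in> {1..m - 1}. birth_time m z u + key_age z u j \<le> ?s} = {}" by blast
      then show "keys_at m t u = 0" unfolding keys by (metis card.empty)
    qed
    then show ?thesis
      using True keys by (simp add: fringe_tree_def family_tree_def ltree_of_def)
  next
    case False
    then show ?thesis
      by (simp add: fringe_tree_def family_tree_def ltree_of_def keys_at_outside[OF t(1)])
  qed
qed

section \<open>Measurability of the fringe tree and of its number of keys\<close>

lemma measurable_fringe_tree:
  assumes Z: "\<And>c. c \<in> clocks m \<Longrightarrow> Z c \<in> borel_measurable M"
  shows "(\<lambda>\<omega>. fringe_tree m (\<lambda>c. Z c \<omega>)) \<in> measurable M tree_space"
proof (rule measurable_tree_spaceI)
  fix u
  show "(\<lambda>\<omega>. fringe_tree m (\<lambda>c. Z c \<omega>) u) \<in> measurable M (count_space UNIV)"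
  proof (cases "u \<in> words m")
    case False
    then show ?thesis by (simp add: fringe_tree_def family_tree_def)
  next
    case True
    have tk: "take k u \<in> words m" for k
      using True by (auto simp: words_def dest: in_set_takeD)
    have age: "(\<lambda>\<omega>. key_age (\<lambda>c. Z c \<omega>) v j) \<in> borel_measurable M" if "v \<in> words m" "j \<le> m - 1" for v j
      unfolding key_age_def using that
      by (intro borel_measurable_sum Z) (auto simp: clocks_def)
    have child: "(\<lambda>\<omega>. Z (Child_Wait (take k u) (u ! k)) \<omega>) \<in> borel_measurable M" if "k < length u" for k
      using that tk[of k] True by (intro Z) (auto simp: clocks_def words_def)
    have [measurable]: "(\<lambda>\<omega>. birth_time m (\<lambda>c. Z c \<omega>) u) \<in> borel_measurable M"
      unfolding birth_time_def by (intro borel_measurable_sum borel_measurable_add age child tk) auto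
    have [measurable]: "Z Sampling \<in> borel_measurable M" by (rule Z) (simp add: clocks_def)
    \<comment> \<open>The label is a cardinality of a random set; as the length of a filtered fixed
      list it becomes a function of a discrete random variable.\<close>
    have "(\<lambda>\<omega>. filter (\<lambda>j. birth_time m (\<lambda>c. Z c \<omega>) u + key_age (\<lambda>c. Z c \<omega>) u j \<le> Z Sampling \<omega>) [1..<m])
        \<in> measurable M (count_space UNIV)"
    proof (rule measurable_filter_list)
      fix j assume "j \<in> set [1..<m]"
      then have [measurable]: "(\<lambda>\<omega>. key_age (\<lambda>c. Z c \<omega>) u j) \<in> borel_measurable M"
        using True by (intro age) auto
      show "Measurable.pred M (\<lambda>\<omega>. birth_time m (\<lambda>c. Z c \<omega>) u + key_age (\<lambda>c. Z c \<omega>) u j \<le> Z Sampling \<omega>)"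
        by measurable
    qed
    then have "(\<lambda>\<omega>. length (filter (\<lambda>j. birth_time m (\<lambda>c. Z c \<omega>) u + key_age (\<lambda>c. Z c \<omega>) u j \<le> Z Sampling \<omega>) [1..<m]))
        \<in> measurable M (count_space UNIV)"
      by (rule measurable_compose) simp
    also have "(\<lambda>\<omega>. length (filter (\<lambda>j. birth_time m (\<lambda>c. Z c \<omega>) u + key_age (\<lambda>c. Z c \<omega>) u j \<le> Z Sampling \<omega>) [1..<m]))
      = (\<lambda>\<omega>. card {j \<in> {1..m - 1}. birth_time m (\<lambda>c. Z c \<omega>) u + key_age (\<lambda>c. Z c \<omega>) u j \<le> Z Sampling \<omega>})"
      by (subst distinct_length_filter) (auto intro!: ext arg_cong[where f=card])
    finally have [measurable]: "(\<lambda>\<omega>. card {j \<in> {1..m - 1}. birth_time m (\<lambda>c. Z c \<omega>) u + key_age (\<lambda>c. Z c \<omega>) u j \<le> Z Sampling \<omega>})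
        \<in> measurable M (count_space UNIV)" .
    show ?thesis
      unfolding fringe_tree_def family_tree_def using True by (simp only: simp_thms) measurable
  qed
qed

text \<open>Replaces the sum over a random domain by a quantifier over the countable type of lists
  of words. Since \<open>k \<ge> 1\<close>, an infinite domain, where the sum is 0 by default,
  cannot satisfy the left side.\<close>

lemma num_keys_eq_iff:
  assumes "k \<ge> 1"
  shows "num_keys t = k \<longleftrightarrow>
    (\<exists>l. distinct l \<and> (\<forall>u. u \<in> set l \<longleftrightarrow> t u \<noteq> None) \<and> sum_list (map (\<lambda>u. the (t u)) l) = k)"
proof
  assume k: "num_keys t = k"
  then have "finite (dom t)" using assms by (rule_tac ccontr) (simp add: num_keys_def)
  then obtain l where l: "set l = dom t" "distinct l" using finite_distinct_list by blast
  then have "sum_list (map (\<lambda>u. the (t u)) l) = k"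
    using k by (simp add: num_keys_def sum_list_distinct_conv_sum_set)
  then show "\<exists>l. distinct l \<and> (\<forall>u. u \<in> set l \<longleftrightarrow> t u \<noteq> None) \<and> sum_list (map (\<lambda>u. the (t u)) l) = k"
    using l by (intro exI[of _ l]) auto
next
  assume "\<exists>l. distinct l \<and> (\<forall>u. u \<in> set l \<longleftrightarrow> t u \<noteq> None) \<and> sum_list (map (\<lambda>u. the (t u)) l) = k"
  then obtain l where l: "distinct l" "\<And>u. u \<in> set l \<longleftrightarrow> t u \<noteq> None" "sum_list (map (\<lambda>u. the (t u)) l) = k"
    by blast
  have "dom t = set l" using l by auto
  then show "num_keys t = k" using l by (simp add: num_keys_def sum_list_distinct_conv_sum_set)
qed

lemma pred_num_keys:
  assumes "k \<ge> 1"
  shows "Measurable.pred tree_space (\<lambda>t. num_keys t = k)"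
proof -
  have comp[measurable]: "(\<lambda>t. t u) \<in> measurable tree_space (count_space UNIV)" for u
    unfolding tree_space_def by simp
  have [measurable]: "(\<lambda>t. sum_list (map (\<lambda>u. the (t u)) l)) \<in> measurable tree_space (count_space UNIV)" for l
  proof (induction l)
    case (Cons u l)
    have "(\<lambda>t. the i + sum_list (map (\<lambda>u. the (t u)) l)) \<in> measurable tree_space (count_space UNIV)" for i
      by (rule measurable_compose[OF Cons]) simp
    from measurable_compose_countable[OF this comp[of u]] show ?case by simp
  qed simp
  show ?thesis unfolding num_keys_eq_iff[OF assms] by measurable
qed

section \<open>The law of the fringe tree\<close>

definition size_prob :: "nat \<Rightarrow> real" where
  "size_prob k = 2 / ((real k + 1) * (real k + 2))"

text \<open>Telescoping of \<open>2 / (k + 1) - 2 / (k + 2)\<close>. The explicit remainder bounds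
  the mass still available beyond \<open>n\<close>.\<close>

lemma sum_size_prob: "(\<Sum>k\<in>{1..n}. size_prob k) = 1 - 2 / (real n + 2)"
proof (induction n)
  case (Suc n)
  have "(\<Sum>k\<in>{1..Suc n}. size_prob k) = 1 - 2 / (real n + 2) + size_prob (Suc n)"
    using Suc by simp
  also have "\<dots> = 1 - 2 / (real (Suc n) + 2)"
    by (simp add: size_prob_def divide_simps) (simp add: algebra_simps)?
  finally show ?case .
qed simp

text \<open>With \<open>v = 1 - exp (- x)\<close> the integral becomes \<open>k\<close> times the
  integral of \<open>(1 - v) ^ 2 * v ^ (k - 1)\<close> over the unit interval. Expanding the square
  gives the three powers in \<open>?F\<close> and the limit \<open>?L\<close>.\<close>

lemma nn_integral_exponential_yule_one:
  assumes "distributed M lborel X (\<lambda>x. ennreal (exponential_density 1 x))" "k \<ge> 1"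
  shows "(\<integral>\<^sup>+ \<omega>. ennreal (real k * yule 1 (k - 1) (X \<omega>)) \<partial>M) = ennreal (size_prob k)"
proof -
  let ?v = "\<lambda>x::real. 1 - exp (- x)"
  let ?f = "\<lambda>x. real k * (exp (- x) * (1 - ?v x)\<^sup>2 * ?v x ^ (k - 1))"
  let ?P = "\<lambda>n x. ?v x ^ Suc n / real (Suc n)"
  let ?F = "\<lambda>x. real k * (?P (k - 1) x - 2 * ?P k x + ?P (Suc k) x)"
  let ?L = "real k * (1 / real k - 2 * (1 / real (Suc k)) + 1 / real (Suc (Suc k)))"
  have "(\<integral>\<^sup>+ \<omega>. ennreal (real k * yule 1 (k - 1) (X \<omega>)) \<partial>M)
     = (\<integral>\<^sup>+ x. ennreal (exponential_density 1 x) * ennreal (real k * yule 1 (k - 1) x) \<partial>lborel)"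
    by (rule distributed_nn_integral[OF assms(1), symmetric]) measurable
  also have "\<dots> = (\<integral>\<^sup>+ x. ennreal (?f x) * indicator {0..} x \<partial>lborel)"
  proof (rule nn_integral_cong)
    fix x :: real
    show "ennreal (exponential_density 1 x) * ennreal (real k * yule 1 (k - 1) x) = ennreal (?f x) * indicator {0..} x"
    proof (cases "x < 0")
      case False
      have "exp (- (2 * x)) = exp (- x) * exp (- x)" by (simp flip: exp_add)
      then show ?thesis using False
        by (simp add: exponential_density_def yule_def power2_eq_square ac_simps flip: ennreal_mult')
    qed (simp add: exponential_density_def)
  qed
  also have "\<dots> = ennreal (?L - ?F 0)"
  proof (rule nn_integral_FTC_atLeast)
    show "?f \<in> borel_measurable borel" by measurable
    fix x :: real assume x: "0 \<le> x"
    then show "0 \<le> ?f x" by simp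
    have dv: "(?v has_real_derivative exp (- x)) (at x)"
      by (auto intro!: derivative_eq_intros)
    have dP: "(?P n has_real_derivative exp (- x) * ?v x ^ n) (at x)" for n
      by (rule DERIV_cong[OF DERIV_cdivide[OF DERIV_power_Suc[OF dv]]])
        (simp add: field_simps del: of_nat_Suc, simp add: algebra_simps)
    have vk: "?v x ^ k = ?v x * ?v x ^ (k - 1)" using assms(2) by (cases k) auto
    show "(?F has_real_derivative ?f x) (at x)"
      by (intro DERIV_cong[OF DERIV_cmult[OF DERIV_add[OF DERIV_diff[OF dP DERIV_cmult[OF dP]] dP]]])
        (simp only: power_Suc vk, simp add: power2_eq_square algebra_simps)
  next
    have "((\<lambda>x::real. exp (- x)) \<longlongrightarrow> 0) at_top"
      by (rule filterlim_compose[OF exp_at_bot filterlim_uminus_at_bot_at_top])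
    then have v: "(?v \<longlongrightarrow> 1 - 0) at_top" by (intro tendsto_intros)
    have "(?P n \<longlongrightarrow> (1 - 0) ^ Suc n / real (Suc n)) at_top" for n
      by (intro tendsto_intros v) simp
    then have P: "(?P n \<longlongrightarrow> 1 / real (Suc n)) at_top" for n by simp
    have P1: "(?P (k - 1) \<longlongrightarrow> 1 / real k) at_top" using P[of "k - 1"] assms(2) by simp
    show "(?F \<longlongrightarrow> ?L) at_top"
      by (intro tendsto_mult_left tendsto_add tendsto_diff P P1)
  qed
  also have "?L - ?F 0 = ?L" by simp
  also have "?L = size_prob k"
    using assms(2) by (simp add: size_prob_def divide_simps) (simp add: algebra_simps)
  finally show ?thesis .
qed

text \<open>The sampling time occupies the slot \<open>([], 1)\<close>, which is missing from
  \<open>slots m 1\<close>; it is therefore independent of the tree grown from a root with one key,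
  and conditioning on it leaves an exponential integral.\<close>

lemma emeasure_occ_sampling:
  assumes m: "m \<ge> 2" and M: "prob_space M"
    and ind: "prob_space.indep_vars M (\<lambda>_. borel) W (slots m 0)"
    and dist: "\<And>u l. (u, l) \<in> slots m 0 \<Longrightarrow>
      distributed M lborel (W (u, l)) (\<lambda>x. ennreal (exponential_density (real l) x))"
    and t: "valid m t" "rkeys m t \<ge> 1"
  shows "emeasure M {\<omega> \<in> space M. occ m 1 t (\<lambda>c. W c \<omega>) (W ([], 1) \<omega>)}
    = ennreal (size_prob (nkeys m t) * weight m t)"
proof -
  interpret prob_space M by fact
  let ?k = "nkeys m t"
  have k: "?k \<ge> 1" using t rkeys_le[of m t] by simp
  have sub: "slots m 1 \<subseteq> slots m 0" by (auto simp: slots_def)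
  have root: "([], 1) \<in> slots m 0" using m by (simp add: slots_Nil)
  let ?X = "\<lambda>\<omega>. restrict (\<lambda>c. W c \<omega>) {([], 1)}"
  let ?Y = "\<lambda>\<omega>. restrict (\<lambda>c. W c \<omega>) (slots m 1)"
  have indep: "indep_var (PiM {([], 1)} (\<lambda>_. borel)) ?X (PiM (slots m 1) (\<lambda>_. borel)) ?Y"
    by (rule indep_var_restrict[OF ind]) (use root sub in \<open>auto simp: slots_Nil\<close>)
  have cong: "occ m 1 t (?Y \<omega>) s = occ m 1 t (\<lambda>c. W c \<omega>) s" for \<omega> s
    by (rule occ_cong[OF t(1)]) simp
  have "emeasure M {\<omega> \<in> space M. occ m 1 t (?Y \<omega>) (?X \<omega> ([], 1))}
      = (\<integral>\<^sup>+ \<omega>. emeasure M {\<omega>' \<in> space M. occ m 1 t (?Y \<omega>') (?X \<omega> ([], 1))} \<partial>M)"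
    by (rule indep_var_emeasure[OF M indep], rule measurable_occ[OF t(1)]) simp_all
  then have "emeasure M {\<omega> \<in> space M. occ m 1 t (\<lambda>c. W c \<omega>) (W ([], 1) \<omega>)}
      = (\<integral>\<^sup>+ \<omega>. emeasure M {\<omega>' \<in> space M. occ m 1 t (\<lambda>c. W c \<omega>') (W ([], 1) \<omega>)} \<partial>M)"
    unfolding cong by simp
  also have "\<dots> = (\<integral>\<^sup>+ \<omega>. ennreal (real (?k choose 1) * weight m t * yule 1 (?k - 1) (W ([], 1) \<omega>)) \<partial>M)"
  proof (intro nn_integral_cong emeasure_occ[OF m M t(1)])
    show "indep_vars (\<lambda>_. borel) W (slots m 1)" by (rule indep_vars_subset[OF ind sub])
    show "distributed M lborel (W (u, l)) (\<lambda>x. ennreal (exponential_density (real l) x))"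
      if "(u, l) \<in> slots m 1" for u l
      using that sub by (intro dist) auto
  qed (use t in auto)
  also have "\<dots> = (\<integral>\<^sup>+ \<omega>. ennreal (weight m t) * ennreal (real ?k * yule 1 (?k - 1) (W ([], 1) \<omega>)) \<partial>M)"
    using weight_pos[of m t]
    by (intro nn_integral_cong) (simp add: ac_simps yule_nonneg flip: ennreal_mult)
  also have "\<dots> = ennreal (weight m t) * (\<integral>\<^sup>+ \<omega>. ennreal (real ?k * yule 1 (?k - 1) (W ([], 1) \<omega>)) \<partial>M)"
  proof (rule nn_integral_cmult)
    have [measurable]: "W ([], 1) \<in> borel_measurable M"
      using distributed_measurable[OF dist[OF root]] by simp
    show "(\<lambda>\<omega>. ennreal (real ?k * yule 1 (?k - 1) (W ([], 1) \<omega>))) \<in> borel_measurable M" by measurable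
  qed
  also have "\<dots> = ennreal (weight m t) * ennreal (size_prob ?k)"
    using dist[OF root] by (subst nn_integral_exponential_yule_one[OF _ k]) auto
  also have "\<dots> = ennreal (size_prob ?k * weight m t)"
    using weight_pos[of m t] by (simp add: size_prob_def mult.commute flip: ennreal_mult)
  finally show ?thesis .
qed

text \<open>
  The trees described by \<open>ktree\<close> give lower bounds for all these probabilities. Since
  \<open>size_prob\<close> sums to 1, no mass is left, and the lower bounds are sharp.
\<close>

theorem fringe_tree_law:
  fixes m :: nat and M :: "'a measure" and Z :: "clock \<Rightarrow> 'a \<Rightarrow> real"
  defines "T \<equiv> \<lambda>\<omega>. fringe_tree m (\<lambda>c. Z c \<omega>)"
  assumes m: "m \<ge> 2" and M: "prob_space M"
    and ind: "prob_space.indep_vars M (\<lambda>_. borel) Z (clocks m)"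
    and dist: "\<And>c. c \<in> clocks m \<Longrightarrow>
           distributed M lborel (Z c) (\<lambda>x. ennreal (exponential_density (clock_rate c) x))"
    and B: "B \<in> sets tree_space" and k: "k \<ge> 1"
  shows "measure M {\<omega> \<in> space M. num_keys (T \<omega>) = k \<and> T \<omega> \<in> B} = size_prob k * tree_prob m k B"
proof -
  interpret prob_space M by fact
  define W where "W c = Z (slot_clock c)" for c
  have Wd: "distributed M lborel (W (u, l)) (\<lambda>x. ennreal (exponential_density (real l) x))"
    if "(u, l) \<in> slots m 0" for u l
    using dist[OF slot_clock_in_clocks[OF that m]] unfolding W_def clock_rate_slot .
  have Wi: "indep_vars (\<lambda>_. borel) W (slots m 0)"
    unfolding W_def
    by (rule indep_vars_reindex'[OF M ind inj_on_slot_clock]) (use slot_clock_in_clocks m in auto)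
  have Zm: "Z c \<in> borel_measurable M" if "c \<in> clocks m" for c
    using distributed_measurable[OF dist[OF that]] by simp
  have Wm[measurable]: "W c \<in> borel_measurable M" if "c \<in> slots m 0" for c
    unfolding W_def using that m by (intro Zm slot_clock_in_clocks)
  have root: "([], 1) \<in> slots m 0" using m by (simp add: slots_Nil)
  have T[measurable]: "T \<in> measurable M tree_space"
    unfolding T_def by (rule measurable_fringe_tree[OF Zm])
  have Km: "Measurable.pred M (\<lambda>\<omega>. num_keys (T \<omega>) = k)" if "k \<ge> 1" for k
    by (rule measurable_compose[OF T pred_num_keys[OF that]])
  \<comment> \<open>Negative clock values form a null event but would break the monotonicity of
    arrival times, so the events \<open>E t\<close> below are intersected with
    \<open>G\<close>.\<close>
  define G where "G \<omega> \<longleftrightarrow> (\<forall>c\<in>slots m 0. W c \<omega> \<ge> 0)" for \<omega>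
  have cnt: "countable (slots m 0)" by (rule countableI_type)
  have G: "AE \<omega> in M. G \<omega>"
    unfolding G_def
  proof (subst AE_ball_countable[OF cnt], intro ballI)
    fix c assume c: "c \<in> slots m 0"
    obtain u l where ul: "c = (u, l)" by (cases c)
    have "AE x in density lborel (\<lambda>x. ennreal (exponential_density (real l) x)). 0 \<le> x"
      by (subst AE_density) (auto simp: exponential_density_def)
    then have "AE x in distr M lborel (W c). 0 \<le> x"
      unfolding ul distributed_distr_eq_density[OF Wd[OF c[unfolded ul]]] .
    then show "AE \<omega> in M. 0 \<le> W c \<omega>"
      using Wm[OF c] by (subst (asm) AE_distr_iff) auto
  qed
  have [measurable]: "Measurable.pred M G"
    unfolding G_def pred_def by (rule sets.sets_Collect_countable_All'[OF _ cnt]) measurable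
  define E where "E t = {\<omega> \<in> space M. occ m 1 t (\<lambda>c. W c \<omega>) (W ([], 1) \<omega>) \<and> G \<omega>}" for t
  have rk: "rkeys m t \<ge> 1" if "t \<in> trees m k" "k \<ge> 1" for t k
    using that m by (cases t) (auto simp: trees_def)
  have E: "E t \<in> events" and PE: "prob (E t) = size_prob k * weight m t"
    and TE: "\<And>\<omega>. \<omega> \<in> E t \<Longrightarrow> T \<omega> = ltree_of m t"
    if t: "t \<in> trees m k" and k: "k \<ge> 1" for t k
  proof -
    have v: "valid m t" "nkeys m t = k" using t by (auto simp: trees_def)
    note r = rk[OF t k]
    have [measurable]: "Measurable.pred M (\<lambda>\<omega>. occ m 1 t (\<lambda>c. W c \<omega>) (W ([], 1) \<omega>))"
      using root by (intro measurable_occ[OF v(1)] Wm) (auto simp: slots_def)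
    show "E t \<in> events" unfolding E_def by measurable
    have "prob (E t) = prob {\<omega> \<in> space M. occ m 1 t (\<lambda>c. W c \<omega>) (W ([], 1) \<omega>)}"
    proof (rule finite_measure_eq_AE)
      show "E t \<in> events" unfolding E_def by measurable
      show "{\<omega> \<in> space M. occ m 1 t (\<lambda>c. W c \<omega>) (W ([], 1) \<omega>)} \<in> events" by measurable
      show "AE \<omega> in M. (\<omega> \<in> E t) = (\<omega> \<in> {\<omega> \<in> space M. occ m 1 t (\<lambda>c. W c \<omega>) (W ([], 1) \<omega>)})"
        using G by eventually_elim (simp add: E_def)
    qed
    also have "\<dots> = size_prob k * weight m t"
      using emeasure_occ_sampling[OF m M Wi Wd v(1) r] v(2) weight_pos[of m t]
      by (simp add: emeasure_eq_measure size_prob_def)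
    finally show "prob (E t) = size_prob k * weight m t" .
    show "T \<omega> = ltree_of m t" if "\<omega> \<in> E t" for \<omega>
      unfolding T_def using that root
      by (intro fringe_tree_eq_ltree_of[OF m v(1) r]) (auto simp: E_def G_def W_def)
  qed
  define \<nu> where "\<nu> k B = prob {\<omega> \<in> space M. num_keys (T \<omega>) = k \<and> T \<omega> \<in> B}" for k B
  have ev: "{\<omega> \<in> space M. num_keys (T \<omega>) = k \<and> T \<omega> \<in> B} \<in> events"
    if "k \<ge> 1" "B \<in> sets tree_space" for k B
    using Km[OF that(1)] measurable_sets[OF T that(2)]
    by (auto simp: pred_def vimage_def Int_def conj_commute intro!: sets.sets_Collect_conj)
  have lower: "size_prob k * tree_prob m k B \<le> \<nu> k B" if kB: "k \<ge> 1" "B \<in> sets tree_space" for k B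
  proof -
    let ?T = "{t. t \<in> trees m k \<and> ltree_of m t \<in> B}"
    have fin: "finite ?T" using finite_trees[OF m, of k] by simp
    \<comment> \<open>On \<open>E t\<close> the fringe tree equals \<open>ltree_of m t\<close>, and
      \<open>ltree_of\<close> is injective on valid trees.\<close>
    have dis: "disjoint_family_on E ?T"
      unfolding disjoint_family_on_def
    proof (intro ballI impI equals0I)
      fix t t' \<omega> assume *: "t \<in> ?T" "t' \<in> ?T" "t \<noteq> t'" "\<omega> \<in> E t \<inter> E t'"
      then have "ltree_of m t = ltree_of m t'"
        using TE[of t k \<omega>] TE[of t' k \<omega>] kB by auto
      then show False using * ltree_of_inj[of m t t'] by (auto simp: trees_def)
    qed
    have "size_prob k * tree_prob m k B = (\<Sum>t\<in>?T. prob (E t))"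
      unfolding tree_prob_def sum_distrib_left by (intro sum.cong refl PE[symmetric]) (use kB in auto)
    also have "\<dots> = prob (\<Union>t\<in>?T. E t)"
      by (rule finite_measure_finite_Union[symmetric]) (use fin dis E kB in auto)
    also have "\<dots> \<le> \<nu> k B"
      unfolding \<nu>_def
    proof (rule finite_measure_mono)
      show "(\<Union>t\<in>?T. E t) \<subseteq> {\<omega> \<in> space M. num_keys (T \<omega>) = k \<and> T \<omega> \<in> B}"
        using TE kB num_keys_ltree_of[OF m] by (auto simp: trees_def E_def)
    qed (rule ev[OF kB])
    finally show ?thesis .
  qed
  have UN: "UNIV \<in> sets tree_space" using sets.top[of tree_space] by simp
  have total: "\<nu> k UNIV = size_prob k" if k: "k \<ge> 1" for k
  proof (rule ccontr)
    assume "\<nu> k UNIV \<noteq> size_prob k"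
    moreover have low: "size_prob j \<le> \<nu> j UNIV" if "j \<ge> 1" for j
      using lower[OF that UN] tree_prob_UNIV[OF m] by simp
    ultimately have d: "\<nu> k UNIV - size_prob k > 0" using low[OF k] by simp
    \<comment> \<open>A surplus \<open>d\<close> at \<open>k\<close> forces
      \<open>1 - 2 / (N + 2) + d \<le> 1\<close> for every \<open>N \<ge> k\<close>, because all
      other terms satisfy the lower bound. Choosing \<open>n > 2 / d\<close> makes this
      impossible.\<close>
    obtain n :: nat where n: "2 / (\<nu> k UNIV - size_prob k) < real n"
      using reals_Archimedean2 by blast
    define N where "N = max n k"
    have "(\<Sum>j\<in>{1..N}. \<nu> j UNIV) = prob (\<Union>j\<in>{1..N}. {\<omega> \<in> space M. num_keys (T \<omega>) = j \<and> T \<omega> \<in> UNIV})"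
      unfolding \<nu>_def
    proof (rule finite_measure_finite_Union[symmetric])
      show "(\<lambda>j. {\<omega> \<in> space M. num_keys (T \<omega>) = j \<and> T \<omega> \<in> UNIV}) ` {1..N} \<subseteq> events"
        using ev[OF _ UN] by (intro image_subsetI) simp
    qed (auto simp: disjoint_family_on_def)
    also have "\<dots> \<le> 1" by simp
    finally have "(\<Sum>j\<in>{1..N}. \<nu> j UNIV) \<le> 1" .
    moreover have "(\<Sum>j\<in>{1..N}. \<nu> j UNIV - size_prob j) \<ge> \<nu> k UNIV - size_prob k"
      using k low by (intro member_le_sum) (auto simp: N_def)
    moreover have "(\<Sum>j\<in>{1..N}. size_prob j) = 1 - 2 / (real N + 2)" by (rule sum_size_prob)
    ultimately have "\<nu> k UNIV - size_prob k \<le> 2 / (real N + 2)"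
      by (simp add: sum_subtractf)
    also have "\<dots> < \<nu> k UNIV - size_prob k"
    proof -
      have "2 < (\<nu> k UNIV - size_prob k) * real n" using n d by (simp add: field_simps)
      also have "\<dots> \<le> (\<nu> k UNIV - size_prob k) * (real N + 2)"
        using d by (intro mult_left_mono) (auto simp: N_def)
      finally show ?thesis by (simp add: field_simps)
    qed
    finally show False by simp
  qed
  have C: "- B \<in> sets tree_space" using sets.compl_sets[OF B] by (simp add: Compl_eq_Diff_UNIV)
  \<comment> \<open>The same squeeze within size \<open>k\<close>: the lower bounds for
    \<open>B\<close> and for its complement add up to the total mass, so both are
    equalities.\<close>
  have "\<nu> k B + \<nu> k (- B) = \<nu> k UNIV"
    unfolding \<nu>_def using ev[OF k B] ev[OF k C]
    by (subst finite_measure_Union[symmetric]) (auto intro!: arg_cong[where f = prob])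
  also have "\<dots> = size_prob k * (tree_prob m k B + tree_prob m k (- B))"
    using total[OF k] tree_prob_Compl[OF m] by simp
  finally have "\<nu> k B + \<nu> k (- B) = size_prob k * tree_prob m k B + size_prob k * tree_prob m k (- B)"
    by (simp add: distrib_left)
  then have "\<nu> k B = size_prob k * tree_prob m k B"
    using lower[OF k B] lower[OF k C] by linarith
  then show ?thesis unfolding \<nu>_def .
qed

theorem theorem7p10:
  fixes m :: nat
    and M :: "'a measure"
    and Z :: "clock \<Rightarrow> 'a \<Rightarrow> real"
    and \<mu> :: "real measure"
  defines "T \<equiv> \<lambda>\<omega>. fringe_tree m (\<lambda>c. Z c \<omega>)"
  defines "K \<equiv> \<lambda>\<omega>. num_keys (T \<omega>)"
  assumes "m \<ge> 2"
    and "prob_space M"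
    and "prob_space.indep_vars M (\<lambda>_. borel) Z (clocks m)"
    and "\<And>c. c \<in> clocks m \<Longrightarrow>
           distributed M lborel (Z c) (\<lambda>x. ennreal (exponential_density (clock_rate c) x))"
    and "real_distribution \<mu>" and "continuous_on UNIV (cdf \<mu>)"
  shows "T \<in> M \<rightarrow>\<^sub>M tree_space
    \<and> (\<forall>k\<ge>1. measure M {\<omega> \<in> space M. K \<omega> = k} = 2 / ((real k + 1) * (real k + 2)))
    \<and> (\<forall>k\<ge>1. distr (uniform_measure M {\<omega> \<in> space M. K \<omega> = k}) tree_space T
              = random_search_tree m \<mu> k)"
proof (intro conjI allI impI)
  interpret prob_space M by fact
  have law: "prob {\<omega> \<in> space M. num_keys (T \<omega>) = k \<and> T \<omega> \<in> B} = size_prob k * tree_prob m k B"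
    if "B \<in> sets tree_space" "k \<ge> 1" for B k
    unfolding T_def by (rule fringe_tree_law[OF assms(3-5) _ that]) (rule assms(6))
  show T: "T \<in> M \<rightarrow>\<^sub>M tree_space"
    unfolding T_def
    by (rule measurable_fringe_tree) (use distributed_measurable[OF assms(6)] in simp)
  fix k :: nat assume k: "k \<ge> 1"
  let ?E = "{\<omega> \<in> space M. K \<omega> = k}"
  have "UNIV \<in> sets tree_space" using sets.top[of tree_space] by simp
  from law[OF this k] have PE: "prob ?E = size_prob k"
    using tree_prob_UNIV[OF assms(3)] by (simp add: K_def)
  then show "prob ?E = 2 / ((real k + 1) * (real k + 2))" by (simp add: size_prob_def)
  have E: "?E \<in> events"
    using measurable_compose[OF T pred_num_keys[OF k]] by (simp add: K_def pred_def)
  show "distr (uniform_measure M ?E) tree_space T = random_search_tree m \<mu> k"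
  proof (rule measure_eqI)
    show "sets (distr (uniform_measure M ?E) tree_space T) = sets (random_search_tree m \<mu> k)"
      by (simp add: random_search_tree_def)
    fix B assume "B \<in> sets (distr (uniform_measure M ?E) tree_space T)"
    then have B: "B \<in> sets tree_space" by simp
    have TB: "T -` B \<inter> space M \<in> events" by (rule measurable_sets[OF T B])
    have TU: "T \<in> measurable (uniform_measure M ?E) tree_space" using T by simp
    have pos: "size_prob k > 0" by (simp add: size_prob_def)
    have tp: "tree_prob m k B \<ge> 0"
      unfolding tree_prob_def by (intro sum_nonneg) (simp add: less_imp_le weight_pos)
    have "emeasure (distr (uniform_measure M ?E) tree_space T) B
        = emeasure (uniform_measure M ?E) (T -` B \<inter> space M)"
      using emeasure_distr[OF TU B] by simp
    also have "\<dots> = emeasure M (?E \<inter> (T -` B \<inter> space M)) / emeasure M ?E"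
      by (rule emeasure_uniform_measure[OF E TB])
    also have "?E \<inter> (T -` B \<inter> space M) = {\<omega> \<in> space M. num_keys (T \<omega>) = k \<and> T \<omega> \<in> B}"
      by (auto simp: K_def)
    \<comment> \<open>The factor \<open>size_prob k\<close>, which is positive, cancels:
      conditioning on the size leaves the law of the shape.\<close>
    also have "emeasure M \<dots> / emeasure M ?E = ennreal (size_prob k * tree_prob m k B / size_prob k)"
      using law[OF B k] PE pos tp by (simp add: emeasure_eq_measure divide_ennreal)
    also have "\<dots> = emeasure (random_search_tree m \<mu> k) B"
      using emeasure_random_search_tree[OF assms(3,7,8) B] pos by simp
    finally show "emeasure (distr (uniform_measure M ?E) tree_space T) B = emeasure (random_search_tree m \<mu> k) B" .
  qed
qed

end
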